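(* Let $\widetilde W$ be an irreducible affine Weyl group with positive root system $\widetilde\Phi^+$. For any biclosed set $B$ in $\widetilde\Phi^+$ and any $x,y\in\widetilde W$ such that $x<_B y$, the interval $[x,y]$ in the poset $(\widetilde W,\le_B)$ is finite, where $\le_B$ is the (left) $B$-twisted strong Bruhat order.
   Context: Affine root system: $\Phi$ is a finite irreducible crystallographic root system in a Euclidean space $V$, with Weyl group $W$, standard positive system $\Phi^+$, $\Phi^-=-\Phi^+$, simple system $\Delta$ and highest root $\rho$. Put $V'=V\oplus\mathbb R\delta$ and extend the inner product by $(\delta,v)=0$ for all $v\in V'$. For $\alpha\in\Phi^+$ let $\{\alpha\}^\wedge=\{\alpha+n\delta\mid n\in\mathbb Z_{\ge0}\}$; for $\alpha\in\Phi^-$ let $\{\alpha\}^\wedge=\{\alpha+(n+1)\delta\mid n\in\mathbb Z_{\ge0}\}$; for $\Lambda\subset\Phi$ let $\Lambda^\wedge=\bigcup_{\alpha\in\Lambda}\{\alpha\}^\wedge$. Positive roots: $\widetilde\Phi^+=\Phi^\wedge$; all roots: $\widetilde\Phi=\Phi^\wedge\uplus-\Phi^\wedge$. $\widetilde W$ is the group generated by the reflections $s_\gamma(v)=v-2\frac{(v,\gamma)}{(\gamma,\gamma)}\gamma$, $\gamma\in\widetilde\Phi$; it is a Coxeter group with simple reflections those in the simple roots $\Delta\cup\{\delta-\rho\}$ and length function $l$. Inversion set: $N(w)=\{\gamma\in\widetilde\Phi^+\mid w^{-1}(\gamma)\in-\widetilde\Phi^+\}$. Biclosed: $\Gamma\subset\widetilde\Phi$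 is closed if $\alpha,\beta\in\Gamma$, $k_1,k_2\in\mathbb R_{\ge0}$, $k_1\alpha+k_2\beta\in\widetilde\Phi$ imply $k_1\alpha+k_2\beta\in\Gamma$; $B\subset\widetilde\Phi^+$ is biclosed if $B$ and $\widetilde\Phi^+\setminus B$ are both closed. Twisted length: $l_B(w)=l(w)-2|N(w^{-1})\cap B|$. Twisted strong Bruhat order: $x\le_B y$ iff $y=t_kt_{k-1}\cdots t_1x$ for some $k\ge0$ and reflections $t_i$ of $\widetilde W$ with $l_B(t_i\cdots t_1x)=l_B(t_{i-1}\cdots t_1x)+1$ for $1\le i\le k$. The interval $[x,y]$ is $\{z\mid x\le_B z\le_B y\}$. *)

theory Defs
  imports "HOL-Analysis.Analysis" "HOL-Algebra.Bij" "HOL-Algebra.Generated_Groups"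
begin

definition root_reflection :: "'a::euclidean_space \<Rightarrow> 'a \<Rightarrow> 'a" where
  "root_reflection \<alpha> v = v - (2 * (v \<bullet> \<alpha>) / (\<alpha> \<bullet> \<alpha>)) *\<^sub>R \<alpha>"

text \<open>Root systems are reduced. They are not required to span the ambient space, so the
  conventions with and without the spanning axiom are both covered.\<close>

definition crystallographic_root_system :: "'a::euclidean_space set \<Rightarrow> bool" where
  "crystallographic_root_system \<Phi> \<longleftrightarrow>
     finite \<Phi> \<and> 0 \<notin> \<Phi> \<and>
     (\<forall>\<alpha>\<in>\<Phi>. \<Phi> \<inter> range (\<lambda>c::real. c *\<^sub>R \<alpha>) = {\<alpha>, - \<alpha>}) \<and>
     (\<forall>\<alpha>\<in>\<Phi>. root_reflection \<alpha> ` \<Phi> = \<Phi>) \<and>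
     (\<forall>\<alpha>\<in>\<Phi>. \<forall>\<beta>\<in>\<Phi>. 2 * (\<alpha> \<bullet> \<beta>) / (\<beta> \<bullet> \<beta>) \<in> \<int>)"

definition irreducible_roots :: "'a::euclidean_space set \<Rightarrow> bool" where
  "irreducible_roots \<Phi> \<longleftrightarrow>
     \<Phi> \<noteq> {} \<and>
     \<not> (\<exists>\<Phi>1 \<Phi>2. \<Phi>1 \<noteq> {} \<and> \<Phi>2 \<noteq> {} \<and> \<Phi>1 \<inter> \<Phi>2 = {} \<and> \<Phi> = \<Phi>1 \<union> \<Phi>2 \<and>
          (\<forall>\<alpha>\<in>\<Phi>1. \<forall>\<beta>\<in>\<Phi>2. \<alpha> \<bullet> \<beta> = 0))"

text \<open>Only used for finite \<open>S\<close>.\<close>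

definition nonneg_combinations :: "'a::real_vector set \<Rightarrow> 'a set" where
  "nonneg_combinations S = {\<Sum>b\<in>S. c b *\<^sub>R b | c. \<forall>b\<in>S. (0::real) \<le> c b}"

definition simple_system :: "'a::euclidean_space set \<Rightarrow> 'a set \<Rightarrow> bool" where
  "simple_system \<Phi> \<Delta> \<longleftrightarrow>
     \<Delta> \<subseteq> \<Phi> \<and> independent \<Delta> \<and>
     (\<forall>\<alpha>\<in>\<Phi>. \<alpha> \<in> nonneg_combinations \<Delta> \<or> - \<alpha> \<in> nonneg_combinations \<Delta>)"

definition positive_roots :: "'a::euclidean_space set \<Rightarrow> 'a set \<Rightarrow> 'a set" where
  "positive_roots \<Phi> \<Delta> = \<Phi> \<inter> nonneg_combinations \<Delta>"

definition highest_root :: "'a::euclidean_space set \<Rightarrow> 'a set \<Rightarrow> 'a \<Rightarrow> bool" where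
  "highest_root \<Phi> \<Delta> \<rho> \<longleftrightarrow> \<rho> \<in> \<Phi> \<and> (\<forall>\<alpha>\<in>\<Phi>. \<rho> - \<alpha> \<in> nonneg_combinations \<Delta>)"

text \<open>The space \<open>V' = V \<oplus> \<real>\<delta>\<close> is the product \<^typ>\<open>'a \<times> real\<close>, with \<open>v + c\<delta>\<close> encoded as
  \<open>(v, c)\<close>. Its bilinear form has \<open>\<delta>\<close> in the radical; it is not the (positive definite) inner
  product of the library's product type.\<close>

definition affine_form :: "'a::euclidean_space \<times> real \<Rightarrow> 'a \<times> real \<Rightarrow> real" where
  "affine_form u v = fst u \<bullet> fst v"

definition affine_reflection :: "'a::euclidean_space \<times> real \<Rightarrow> 'a \<times> real \<Rightarrow> 'a \<times> real" where
  "affine_reflection \<gamma> v = v - (2 * affine_form v \<gamma> / affine_form \<gamma> \<gamma>) *\<^sub>R \<gamma>"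

definition root_hat ::
    "'a::euclidean_space set \<Rightarrow> 'a set \<Rightarrow> 'a set \<Rightarrow> ('a \<times> real) set" where
  "root_hat \<Phi> \<Delta> \<Lambda> =
     {(\<alpha>, real n) | \<alpha> n. \<alpha> \<in> \<Lambda> \<inter> positive_roots \<Phi> \<Delta>} \<union>
     {(\<alpha>, real (n + 1)) | \<alpha> n. \<alpha> \<in> \<Lambda> \<inter> uminus ` positive_roots \<Phi> \<Delta>}"

definition affine_positive_roots :: "'a::euclidean_space set \<Rightarrow> 'a set \<Rightarrow> ('a \<times> real) set" where
  "affine_positive_roots \<Phi> \<Delta> = root_hat \<Phi> \<Delta> \<Phi>"

definition affine_roots :: "'a::euclidean_space set \<Rightarrow> 'a set \<Rightarrow> ('a \<times> real) set" where
  "affine_roots \<Phi> \<Delta> = affine_positive_roots \<Phi> \<Delta> \<union> uminus ` affine_positive_roots \<Phi> \<Delta>"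

definition affine_simple_roots :: "'a::euclidean_space set \<Rightarrow> 'a \<Rightarrow> ('a \<times> real) set" where
  "affine_simple_roots \<Delta> \<rho> = (\<lambda>\<alpha>. (\<alpha>, 0)) ` \<Delta> \<union> {(- \<rho>, 1)}"

definition affine_weyl_group ::
    "'a::euclidean_space set \<Rightarrow> 'a set \<Rightarrow> ('a \<times> real \<Rightarrow> 'a \<times> real) set" where
  "affine_weyl_group \<Phi> \<Delta> = generate (BijGroup UNIV) (affine_reflection ` affine_roots \<Phi> \<Delta>)"

definition affine_length ::
    "'a::euclidean_space set \<Rightarrow> 'a \<Rightarrow> ('a \<times> real \<Rightarrow> 'a \<times> real) \<Rightarrow> nat" where
  "affine_length \<Delta> \<rho> w =
     (LEAST n. \<exists>ss. set ss \<subseteq> affine_reflection ` affine_simple_roots \<Delta> \<rho> \<and>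
                    length ss = n \<and> w = foldr (\<circ>) ss id)"

definition inversion_set ::
    "'a::euclidean_space set \<Rightarrow> 'a set \<Rightarrow> ('a \<times> real \<Rightarrow> 'a \<times> real) \<Rightarrow> ('a \<times> real) set" where
  "inversion_set \<Phi> \<Delta> w =
     {\<gamma> \<in> affine_positive_roots \<Phi> \<Delta>. inv_into UNIV w \<gamma> \<in> uminus ` affine_positive_roots \<Phi> \<Delta>}"

definition closed_roots ::
    "'a::euclidean_space set \<Rightarrow> 'a set \<Rightarrow> ('a \<times> real) set \<Rightarrow> bool" where
  "closed_roots \<Phi> \<Delta> \<Gamma> \<longleftrightarrow>
     \<Gamma> \<subseteq> affine_roots \<Phi> \<Delta> \<and>
     (\<forall>\<alpha>\<in>\<Gamma>. \<forall>\<beta>\<in>\<Gamma>. \<forall>k1 k2 :: real. 0 \<le> k1 \<longrightarrow> 0 \<le> k2 \<longrightarrow>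
        k1 *\<^sub>R \<alpha> + k2 *\<^sub>R \<beta> \<in> affine_roots \<Phi> \<Delta> \<longrightarrow> k1 *\<^sub>R \<alpha> + k2 *\<^sub>R \<beta> \<in> \<Gamma>)"

definition biclosed ::
    "'a::euclidean_space set \<Rightarrow> 'a set \<Rightarrow> ('a \<times> real) set \<Rightarrow> bool" where
  "biclosed \<Phi> \<Delta> B \<longleftrightarrow>
     B \<subseteq> affine_positive_roots \<Phi> \<Delta> \<and>
     closed_roots \<Phi> \<Delta> B \<and> closed_roots \<Phi> \<Delta> (affine_positive_roots \<Phi> \<Delta> - B)"

definition twisted_length ::
    "'a::euclidean_space set \<Rightarrow> 'a set \<Rightarrow> 'a \<Rightarrow> ('a \<times> real) set \<Rightarrow>
     ('a \<times> real \<Rightarrow> 'a \<times> real) \<Rightarrow> int" where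
  "twisted_length \<Phi> \<Delta> \<rho> B w =
     int (affine_length \<Delta> \<rho> w) - 2 * int (card (inversion_set \<Phi> \<Delta> (inv_into UNIV w) \<inter> B))"

definition twisted_step ::
    "'a::euclidean_space set \<Rightarrow> 'a set \<Rightarrow> 'a \<Rightarrow> ('a \<times> real) set \<Rightarrow>
     ('a \<times> real \<Rightarrow> 'a \<times> real) \<Rightarrow> ('a \<times> real \<Rightarrow> 'a \<times> real) \<Rightarrow> bool" where
  "twisted_step \<Phi> \<Delta> \<rho> B u v \<longleftrightarrow>
     (\<exists>t \<in> affine_reflection ` affine_roots \<Phi> \<Delta>. v = t \<circ> u) \<and>
     twisted_length \<Phi> \<Delta> \<rho> B v = twisted_length \<Phi> \<Delta> \<rho> B u + 1"

definition twisted_le ::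
    "'a::euclidean_space set \<Rightarrow> 'a set \<Rightarrow> 'a \<Rightarrow> ('a \<times> real) set \<Rightarrow>
     ('a \<times> real \<Rightarrow> 'a \<times> real) \<Rightarrow> ('a \<times> real \<Rightarrow> 'a \<times> real) \<Rightarrow> bool" where
  "twisted_le \<Phi> \<Delta> \<rho> B = (twisted_step \<Phi> \<Delta> \<rho> B)\<^sup>*\<^sup>*"

definition twisted_interval ::
    "'a::euclidean_space set \<Rightarrow> 'a set \<Rightarrow> 'a \<Rightarrow> ('a \<times> real) set \<Rightarrow>
     ('a \<times> real \<Rightarrow> 'a \<times> real) \<Rightarrow> ('a \<times> real \<Rightarrow> 'a \<times> real) \<Rightarrow>
     ('a \<times> real \<Rightarrow> 'a \<times> real) set" where
  "twisted_interval \<Phi> \<Delta> \<rho> B x y =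
     {z \<in> affine_weyl_group \<Phi> \<Delta>. twisted_le \<Phi> \<Delta> \<rho> B x z \<and> twisted_le \<Phi> \<Delta> \<rho> B z y}"

end

theory Submission
  imports Defs
begin

text \<open>Let \<open>P\<close> be the positive affine roots and \<open>P\<^sub>B = (P - B) \<union> -B\<close>. For \<open>\<alpha> \<in> P\<^sub>B\<close>, comparing
  inversion sets along the orbits of \<open>s\<^sub>\<alpha>\<close> shows that \<open>l\<^sub>B(u s\<^sub>\<alpha>) = l\<^sub>B(u) + 1\<close> forces
  \<open>\<alpha> \<in> Q = P\<^sub>B \<inter> u\<^sup>-\<^sup>1P\<close>, and that no root \<open>\<gamma> \<noteq> \<alpha>\<close> of \<open>Q\<close> has \<open>-s\<^sub>\<alpha>(\<gamma>) \<in> Q\<close>. Suppose that for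
  some \<open>a \<in> \<Phi>\<close> infinitely many \<open>a + n\<delta>\<close> had this property. Choose three of them, with coefficients
  \<open>m\<close>, \<open>n\<close>, \<open>p\<close>, such that \<open>2n - m\<close> lies between \<open>m\<close> and \<open>p\<close>. As \<open>Q\<close> is closed, it contains
  \<open>a + (2n - m)\<delta> = -s\<^sub>\<alpha>(a + m\<delta>)\<close> for \<open>\<alpha> = a + n\<delta>\<close>, a contradiction. Since \<open>\<Phi>\<close> is finite, every
  element has finitely many upper covers; the chains from \<open>x\<close> to \<open>y\<close> have length
  \<open>l\<^sub>B(y) - l\<^sub>B(x)\<close>, so the interval is finite.\<close>

section \<open>Cones of nonnegative combinations\<close>

lemma nonneg_combinationsI:
  assumes "u = (\<Sum>b\<in>S. c b *\<^sub>R b)" "\<And>b. b \<in> S \<Longrightarrow> (0::real) \<le> c b"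
  shows "u \<in> nonneg_combinations S"
  using assms unfolding nonneg_combinations_def by auto

lemma nonneg_combinations_scale_base:
  assumes "finite S" "b \<in> S" "(0::real) \<le> k"
  shows "k *\<^sub>R b \<in> nonneg_combinations S"
proof -
  have "k *\<^sub>R b = (\<Sum>s\<in>S. (if s = b then k else 0) *\<^sub>R s)"
    using assms by (simp add: if_distrib[of "\<lambda>c. c *\<^sub>R _"] sum.delta cong: if_cong)
  then show ?thesis by (rule nonneg_combinationsI) (simp add: assms(3))
qed

lemma nonneg_combinations_add:
  assumes "u \<in> nonneg_combinations S" "v \<in> nonneg_combinations S"
  shows "u + v \<in> nonneg_combinations S"
proof -
  obtain c d where c: "u = (\<Sum>b\<in>S. c b *\<^sub>R b)" "\<forall>b\<in>S. 0 \<le> c b"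
    and d: "v = (\<Sum>b\<in>S. d b *\<^sub>R b)" "\<forall>b\<in>S. 0 \<le> d b"
    using assms unfolding nonneg_combinations_def by blast
  show ?thesis
    using c d by (intro nonneg_combinationsI[of _ "\<lambda>b. c b + d b"])
      (auto simp: scaleR_add_left sum.distrib)
qed

lemma nonneg_combinations_scale:
  assumes "u \<in> nonneg_combinations S" "0 \<le> k"
  shows "k *\<^sub>R u \<in> nonneg_combinations S"
proof -
  obtain c where c: "u = (\<Sum>b\<in>S. c b *\<^sub>R b)" "\<forall>b\<in>S. 0 \<le> c b"
    using assms unfolding nonneg_combinations_def by blast
  show ?thesis
    using c assms(2) by (intro nonneg_combinationsI[of _ "\<lambda>b. k * c b"])
      (auto simp: scaleR_sum_right)
qed

lemma nonneg_combinations_sum: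
  assumes "\<And>i. i \<in> I \<Longrightarrow> f i \<in> nonneg_combinations S"
  shows "sum f I \<in> nonneg_combinations S"
  using assms
proof (induction I rule: infinite_finite_induct)
  case (insert i I)
  then show ?case by (simp add: nonneg_combinations_add)
qed (auto simp: nonneg_combinations_def intro!: exI[of _ "\<lambda>_. 0"])

text \<open>Fix any \<open>m\<close> in \<open>A\<close>; infinitely many elements lie on one side
  of it. Take \<open>n\<close> on that side. Only finitely many integers lie between
  \<open>m\<close> and its mirror image \<open>2 * n - m\<close>, so some \<open>p\<close> in
  \<open>A\<close> lies beyond that image.\<close>

lemma infinite_int_reflection_between:
  fixes A :: "int set"
  assumes "infinite A"
  obtains m n p where "m \<in> A" "n \<in> A" "p \<in> A" "n \<noteq> m"
    "m \<le> 2 * n - m \<and> 2 * n - m \<le> p \<or> p \<le> 2 * n - m \<and> 2 * n - m \<le> m"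
proof -
  obtain m where m: "m \<in> A" using assms by (metis finite.emptyI equals0I)
  have "A \<subseteq> (A \<inter> {m<..}) \<union> (A \<inter> {..<m}) \<union> {m}" by auto
  then consider "infinite (A \<inter> {m<..})" | "infinite (A \<inter> {..<m})"
    using assms by (meson finite.emptyI finite_UnI finite_insert finite_subset)
  then show ?thesis
  proof cases
    case 1
    then obtain n where n: "n \<in> A" "n > m" by (metis IntE finite.emptyI equals0I greaterThan_iff)
    have "\<not> A \<inter> {m<..} \<subseteq> {m..2 * n - m}" using 1 finite_subset by blast
    then obtain p where "p \<in> A" "p > 2 * n - m" by force
    with m n show ?thesis by (intro that[of m n p]) auto
  next
    case 2
    then obtain n where n: "n \<in> A" "n < m" by (metis IntE finite.emptyI equals0I lessThan_iff)
    have "\<not> A \<inter> {..<m} \<subseteq> {2 * n - m..m}" using 2 finite_subset by blast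
    then obtain p where "p \<in> A" "p < 2 * n - m" by force
    with m n show ?thesis by (intro that[of m n p]) auto
  qed
qed

subsection \<open>Affine reflections\<close>

lemma linear_affine_reflection: "linear (affine_reflection \<gamma>)"
  by (rule linearI)
    (auto simp: affine_reflection_def affine_form_def inner_add_left algebra_simps add_divide_distrib)

lemma affine_form_reflection:
  "affine_form (affine_reflection \<gamma> u) (affine_reflection \<gamma> v) = affine_form u v"
  \<comment> \<open>If \<open>fst \<gamma> = 0\<close>, the quotient is 0 by the convention for
    division and the reflection is the identity.\<close>
  by (cases "fst \<gamma> = 0")
    (simp_all add: affine_reflection_def affine_form_def inner_diff_left inner_diff_right
      inner_commute field_simps)

lemma affine_reflection_involution:
  assumes "fst \<gamma> \<noteq> 0"
  shows "affine_reflection \<gamma> (affine_reflection \<gamma> v) = v"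
  using assms by (simp add: affine_reflection_def affine_form_def inner_diff_left
      inner_diff_right algebra_simps)

lemma affine_reflection_uminus: "affine_reflection (- \<gamma>) = affine_reflection \<gamma>"
  by (auto simp: affine_reflection_def affine_form_def fun_eq_iff)

text \<open>The usual formula for the conjugate of a reflection, multiplied by \<open>w\<close> on
  the right so that no inverse occurs.\<close>

lemma affine_reflection_conj:
  assumes "linear w" "\<And>u v. affine_form (w u) (w v) = affine_form u v"
  shows "affine_reflection (w \<gamma>) \<circ> w = w \<circ> affine_reflection \<gamma>"
  by (auto simp: fun_eq_iff affine_reflection_def assms linear_diff[OF assms(1)] linear_scale[OF assms(1)])

lemma affine_reflection_self:
  assumes "fst \<gamma> \<noteq> 0"
  shows "affine_reflection \<gamma> \<gamma> = - \<gamma>"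
  using assms by (simp add: affine_reflection_def affine_form_def scaleR_2)

subsection \<open>Half systems\<close>

text \<open>An abstract positive system. The positive affine roots, their \<open>B\<close>-twist and
  the preimages of such sets under symmetries are all of this kind, so the effect of a reflection on
  signs is studied once for all of them.\<close>

definition half_system :: "'v::real_vector set \<Rightarrow> 'v set \<Rightarrow> bool" where
  "half_system R H \<longleftrightarrow> H \<subseteq> R \<and> (\<forall>\<gamma>\<in>R. - \<gamma> \<in> H \<longleftrightarrow> \<gamma> \<notin> H) \<and>
     (\<forall>\<alpha>\<in>H. \<forall>\<beta>\<in>H. \<forall>j k::real. 0 \<le> j \<longrightarrow> 0 \<le> k \<longrightarrow> j *\<^sub>R \<alpha> + k *\<^sub>R \<beta> \<in> R \<longrightarrow>
        j *\<^sub>R \<alpha> + k *\<^sub>R \<beta> \<in> H)"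

lemma half_systemI:
  assumes "H \<subseteq> R" "\<And>\<gamma>. \<gamma> \<in> R \<Longrightarrow> - \<gamma> \<in> H \<longleftrightarrow> \<gamma> \<notin> H"
    and "\<And>\<alpha> \<beta> j k. \<lbrakk>\<alpha> \<in> H; \<beta> \<in> H; (0::real) \<le> j; (0::real) \<le> k; j *\<^sub>R \<alpha> + k *\<^sub>R \<beta> \<in> R\<rbrakk>
      \<Longrightarrow> j *\<^sub>R \<alpha> + k *\<^sub>R \<beta> \<in> H"
  shows "half_system R H"
  using assms by (simp add: half_system_def)

lemma half_systemD:
  assumes "half_system R H"
  shows "\<alpha> \<in> H \<Longrightarrow> \<alpha> \<in> R"
    and "\<alpha> \<in> R \<Longrightarrow> - \<alpha> \<in> H \<longleftrightarrow> \<alpha> \<notin> H"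
    and "\<lbrakk>\<alpha> \<in> H; \<beta> \<in> H; (0::real) \<le> j; (0::real) \<le> k; j *\<^sub>R \<alpha> + k *\<^sub>R \<beta> \<in> R\<rbrakk>
      \<Longrightarrow> j *\<^sub>R \<alpha> + k *\<^sub>R \<beta> \<in> H"
  using assms by (auto simp: half_system_def)

text \<open>With signs in place of membership, counting inversions becomes summing differences, and
  passing to the opposite root only changes a sign.\<close>

definition half_sign :: "'v set \<Rightarrow> 'v \<Rightarrow> int" where
  "half_sign H \<gamma> = (if \<gamma> \<in> H then 1 else - 1)"

lemma half_sign_uminus:
  assumes "half_system R H" "\<gamma> \<in> R"
  shows "half_sign H (- \<gamma>) = - half_sign H \<gamma>"
  using assms by (auto simp: half_system_def half_sign_def)

lemma half_sign_translate:
  assumes H: "half_system R H" "\<alpha> \<in> H" "\<gamma> \<in> R" "\<gamma> + k *\<^sub>R \<alpha> \<in> R" "0 \<le> k"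
  shows "half_sign H \<gamma> \<le> half_sign H (\<gamma> + k *\<^sub>R \<alpha>)"
proof -
  have "\<gamma> + k *\<^sub>R \<alpha> \<in> H" if "\<gamma> \<in> H"
  proof -
    have "1 *\<^sub>R \<gamma> + k *\<^sub>R \<alpha> \<in> H"
      using H[unfolded half_system_def] assms(2-5) that by (metis scaleR_one zero_le_one)
    then show ?thesis by simp
  qed
  then show ?thesis by (auto simp: half_sign_def)
qed

text \<open>The reflection moves \<open>\<gamma>\<close> by \<open>- k\<close> times
  \<open>\<alpha>\<close>, an element of \<open>H\<close>, so \<open>half_sign_translate\<close>
  applies to the image of \<open>\<gamma>\<close> or to \<open>\<gamma>\<close> itself, according to
  the sign of \<open>k\<close>.\<close>

lemma half_sign_reflection:
  assumes H: "half_system R H" and "\<alpha> \<in> H" "\<gamma> \<in> R" "affine_reflection \<alpha> \<gamma> \<in> R"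
  defines "k \<equiv> 2 * affine_form \<gamma> \<alpha> / affine_form \<alpha> \<alpha>"
  shows "0 \<le> k \<Longrightarrow> half_sign H (affine_reflection \<alpha> \<gamma>) \<le> half_sign H \<gamma>"
    and "k \<le> 0 \<Longrightarrow> half_sign H \<gamma> \<le> half_sign H (affine_reflection \<alpha> \<gamma>)"
  using half_sign_translate[OF H \<open>\<alpha> \<in> H\<close> assms(4), of k]
    half_sign_translate[OF H \<open>\<alpha> \<in> H\<close> assms(3), of "- k"] assms(3,4)
  by (simp_all add: affine_reflection_def k_def)

text \<open>The coefficient that decides the sign of a difference depends on \<open>\<alpha>\<close>
  and \<open>\<gamma>\<close> only, not on the half system.\<close>

lemma half_sign_reflection_mult_nonneg:
  assumes "half_system R H" "half_system R K" "\<alpha> \<in> H" "\<alpha> \<in> K"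
    and "\<gamma> \<in> R" "affine_reflection \<alpha> \<gamma> \<in> R"
  shows "0 \<le> (half_sign H \<gamma> - half_sign H (affine_reflection \<alpha> \<gamma>)) *
             (half_sign K \<gamma> - half_sign K (affine_reflection \<alpha> \<gamma>))"
  using half_sign_reflection[OF assms(1,3,5,6)] half_sign_reflection[OF assms(2,4,5,6)]
  by (smt (verit) mult_nonneg_nonneg mult_nonpos_nonpos)

text \<open>The root \<open>- \<alpha>\<close> defines the same reflection but the opposite
  coefficient, so the two differences are governed by opposite signs.\<close>

lemma half_sign_reflection_mult_nonpos:
  assumes "half_system R H" "half_system R K" "\<alpha> \<in> H" "- \<alpha> \<in> K"
    and "\<gamma> \<in> R" "affine_reflection \<alpha> \<gamma> \<in> R"
  shows "(half_sign H \<gamma> - half_sign H (affine_reflection \<alpha> \<gamma>)) *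
             (half_sign K \<gamma> - half_sign K (affine_reflection \<alpha> \<gamma>)) \<le> 0"
proof -
  have "affine_form \<gamma> (- \<alpha>) = - affine_form \<gamma> \<alpha>" "affine_form (- \<alpha>) (- \<alpha>) = affine_form \<alpha> \<alpha>"
    by (simp_all add: affine_form_def)
  then show ?thesis
    using half_sign_reflection[OF assms(1,3,5,6)]
      half_sign_reflection[OF assms(2,4,5), unfolded affine_reflection_uminus, OF assms(6)]
    by (cases "0 \<le> 2 * affine_form \<gamma> \<alpha> / affine_form \<alpha> \<alpha>")
      (simp_all add: mult_le_0_iff)
qed

subsection \<open>Affine roots and simple reflections\<close>

locale affine_root_datum =
  fixes \<Phi> \<Delta> :: "'a::euclidean_space set" and \<rho> :: 'a
  assumes roots: "crystallographic_root_system \<Phi>"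
    and simple: "simple_system \<Phi> \<Delta>"
    and highest: "highest_root \<Phi> \<Delta> \<rho>"
begin

abbreviation "P \<equiv> affine_positive_roots \<Phi> \<Delta>"
abbreviation "R \<equiv> affine_roots \<Phi> \<Delta>"
abbreviation "S \<equiv> affine_simple_roots \<Delta> \<rho>"

section \<open>Positivity of finite and affine roots in coordinates\<close>

lemma finite_roots: "finite \<Phi>" and zero_not_root: "0 \<notin> \<Phi>"
  and root_multiples: "\<alpha> \<in> \<Phi> \<Longrightarrow> c *\<^sub>R \<alpha> \<in> \<Phi> \<Longrightarrow> c *\<^sub>R \<alpha> = \<alpha> \<or> c *\<^sub>R \<alpha> = - \<alpha>"
  and uminus_root: "\<alpha> \<in> \<Phi> \<Longrightarrow> - \<alpha> \<in> \<Phi>"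
  and root_reflection_root: "\<alpha> \<in> \<Phi> \<Longrightarrow> \<beta> \<in> \<Phi> \<Longrightarrow> root_reflection \<alpha> \<beta> \<in> \<Phi>"
  and cartan_integer: "\<alpha> \<in> \<Phi> \<Longrightarrow> \<beta> \<in> \<Phi> \<Longrightarrow> 2 * (\<alpha> \<bullet> \<beta>) / (\<beta> \<bullet> \<beta>) \<in> \<int>"
  using roots unfolding crystallographic_root_system_def by blast+

lemma finite_simple: "finite \<Delta>"
  using simple finite_roots finite_subset unfolding simple_system_def by blast

lemma finite_affine_simple: "finite S"
  by (simp add: affine_simple_roots_def finite_simple)

text \<open>The cone of an independent set is pointed: adding the two expansions gives a vanishing
  combination with coefficients \<open>c b + d b\<close>, and as both terms are nonnegative, each is
  0.\<close>

lemma nonneg_combinations_simple_antisym: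
  assumes "v \<in> nonneg_combinations \<Delta>" "- v \<in> nonneg_combinations \<Delta>"
  shows "v = 0"
proof -
  obtain c where c: "v = (\<Sum>b\<in>\<Delta>. c b *\<^sub>R b)" "\<forall>b\<in>\<Delta>. 0 \<le> c b"
    using assms unfolding nonneg_combinations_def by blast
  obtain d where d: "- v = (\<Sum>b\<in>\<Delta>. d b *\<^sub>R b)" "\<forall>b\<in>\<Delta>. 0 \<le> d b"
    using assms unfolding nonneg_combinations_def by blast
  have "(\<Sum>b\<in>\<Delta>. (c b + d b) *\<^sub>R b) = 0"
    using c d by (simp add: scaleR_add_left sum.distrib flip: c(1) d(1))
  moreover have "independent \<Delta>" using simple by (simp add: simple_system_def)
  ultimately have "\<forall>b\<in>\<Delta>. c b + d b = 0"
    using independentD[OF _ finite_simple order_refl, of "\<lambda>b. c b + d b"] by blast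
  then have "\<forall>b\<in>\<Delta>. c b = 0" using c d by (smt (verit))
  then show ?thesis using c by simp
qed

lemma positive_roots_uminus_iff:
  assumes "\<alpha> \<in> \<Phi>"
  shows "- \<alpha> \<in> positive_roots \<Phi> \<Delta> \<longleftrightarrow> \<alpha> \<notin> positive_roots \<Phi> \<Delta>"
  using assms simple nonneg_combinations_simple_antisym uminus_root zero_not_root
  unfolding positive_roots_def simple_system_def by auto

text \<open>The two families of \<open>root_hat\<close> become one lexicographic condition: first
  the sign of the coefficient of \<delta>, then the finite part.\<close>

lemma affine_positive_roots_iff:
  "\<gamma> \<in> P \<longleftrightarrow> fst \<gamma> \<in> \<Phi> \<and> snd \<gamma> \<in> \<int> \<and>
     (snd \<gamma> > 0 \<or> snd \<gamma> = 0 \<and> fst \<gamma> \<in> positive_roots \<Phi> \<Delta>)"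
proof
  have "positive_roots \<Phi> \<Delta> \<subseteq> \<Phi>" by (simp add: positive_roots_def)
  then show "\<gamma> \<in> P \<Longrightarrow> fst \<gamma> \<in> \<Phi> \<and> snd \<gamma> \<in> \<int> \<and>
     (snd \<gamma> > 0 \<or> snd \<gamma> = 0 \<and> fst \<gamma> \<in> positive_roots \<Phi> \<Delta>)"
    by (auto simp: affine_positive_roots_def root_hat_def)
next
  assume *: "fst \<gamma> \<in> \<Phi> \<and> snd \<gamma> \<in> \<int> \<and>
     (snd \<gamma> > 0 \<or> snd \<gamma> = 0 \<and> fst \<gamma> \<in> positive_roots \<Phi> \<Delta>)"
  then obtain i where i: "snd \<gamma> = real_of_int i" by (auto elim: Ints_cases)
  show "\<gamma> \<in> P"
  proof (cases "fst \<gamma> \<in> positive_roots \<Phi> \<Delta>")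
    case True
    then have "\<gamma> = (fst \<gamma>, real (nat i))" using * i by (auto simp: prod_eq_iff)
    then show ?thesis unfolding affine_positive_roots_def root_hat_def using True * by blast
  next
    case False
    \<comment> \<open>A negative finite part needs a strictly positive coefficient; this accounts
      for the \<open>n + 1\<close> in \<open>root_hat\<close>, with
      \<open>n = i - 1\<close>.\<close>
    then have "i > 0" using * i by auto
    then have "\<gamma> = (fst \<gamma>, real (nat (i - 1) + 1))" using i by (auto simp: prod_eq_iff)
    moreover have "fst \<gamma> \<in> \<Phi> \<inter> uminus ` positive_roots \<Phi> \<Delta>"
      using False * positive_roots_uminus_iff[of "fst \<gamma>"] by force
    ultimately show ?thesis unfolding affine_positive_roots_def root_hat_def by blast
  qed
qed

lemma affine_roots_iff: "\<gamma> \<in> R \<longleftrightarrow> fst \<gamma> \<in> \<Phi> \<and> snd \<gamma> \<in> \<int>"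
proof
  assume "\<gamma> \<in> R"
  then show "fst \<gamma> \<in> \<Phi> \<and> snd \<gamma> \<in> \<int>"
    by (auto simp: affine_roots_def affine_positive_roots_iff uminus_root)
next
  assume *: "fst \<gamma> \<in> \<Phi> \<and> snd \<gamma> \<in> \<int>"
  have "\<gamma> \<in> P \<or> - \<gamma> \<in> P"
    using * positive_roots_uminus_iff[of "fst \<gamma>"]
    by (auto simp: affine_positive_roots_iff uminus_root)
  then show "\<gamma> \<in> R" unfolding affine_roots_def by (metis UnCI imageI minus_minus)
qed

lemma P_subset_R: "P \<subseteq> R"
  by (simp add: affine_roots_def)

lemma uminus_R: "\<gamma> \<in> R \<Longrightarrow> - \<gamma> \<in> R"
  by (simp add: affine_roots_iff uminus_root)

lemma fst_root_nonzero: "\<gamma> \<in> R \<Longrightarrow> fst \<gamma> \<noteq> 0"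
  using zero_not_root by (auto simp: affine_roots_iff)

lemma uminus_P_iff: "\<gamma> \<in> R \<Longrightarrow> - \<gamma> \<in> P \<longleftrightarrow> \<gamma> \<notin> P"
  using positive_roots_uminus_iff[of "fst \<gamma>"]
  by (auto simp: affine_positive_roots_iff affine_roots_iff uminus_root)

lemma mem_uminus_P_iff: "\<gamma> \<in> R \<Longrightarrow> \<gamma> \<in> uminus ` P \<longleftrightarrow> \<gamma> \<notin> P"
  using uminus_P_iff[of \<gamma>] by (metis image_iff minus_minus)

text \<open>The finite part is reflected inside \<Phi>, and the Cartan integers keep the coefficient
  of \<delta> integral.\<close>

lemma affine_reflection_root:
  assumes "\<gamma> \<in> R" "\<beta> \<in> R"
  shows "affine_reflection \<gamma> \<beta> \<in> R"
proof -
  have "fst (affine_reflection \<gamma> \<beta>) = root_reflection (fst \<gamma>) (fst \<beta>)"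
    by (simp add: affine_reflection_def affine_form_def root_reflection_def)
  moreover have "snd (affine_reflection \<gamma> \<beta>) =
      snd \<beta> - (2 * (fst \<beta> \<bullet> fst \<gamma>) / (fst \<gamma> \<bullet> fst \<gamma>)) * snd \<gamma>"
    by (simp add: affine_reflection_def affine_form_def)
  ultimately show ?thesis
    using assms root_reflection_root cartan_integer[of "fst \<beta>" "fst \<gamma>"]
    by (auto simp only: affine_roots_iff intro!: Ints_diff Ints_mult)
qed

lemma affine_root_multiples:
  assumes "\<gamma> \<in> R" "c *\<^sub>R \<gamma> \<in> R"
  shows "c *\<^sub>R \<gamma> = \<gamma> \<or> c *\<^sub>R \<gamma> = - \<gamma>"
proof -
  have "c *\<^sub>R fst \<gamma> = 1 *\<^sub>R fst \<gamma> \<or> c *\<^sub>R fst \<gamma> = (-1) *\<^sub>R fst \<gamma>"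
    using root_multiples[of "fst \<gamma>" c] assms by (simp add: affine_roots_iff)
  then have "c = 1 \<or> c = - 1" using fst_root_nonzero[OF assms(1)] scaleR_cancel_right by blast
  then show ?thesis by auto
qed

section \<open>Expansions in the affine simple roots and the height\<close>

lemma highest_positive: "\<rho> \<in> nonneg_combinations \<Delta>"
proof -
  \<comment> \<open>Comparing the highest root with its own negative puts twice \<rho> into the
    cone; it remains to halve.\<close>
  have "\<rho> - (- \<rho>) \<in> nonneg_combinations \<Delta>"
    using highest uminus_root unfolding highest_root_def by blast
  then have "(1/2) *\<^sub>R (\<rho> + \<rho>) \<in> nonneg_combinations \<Delta>"
    by (intro nonneg_combinations_scale) auto
  then show ?thesis by (simp flip: scaleR_2)
qed

lemma affine_simple_subset_P: "S \<subseteq> P"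
proof -
  have "\<Delta> \<subseteq> positive_roots \<Phi> \<Delta>"
    using simple nonneg_combinations_scale_base[OF finite_simple, of _ 1]
    by (auto simp: positive_roots_def simple_system_def)
  moreover have "- \<rho> \<in> \<Phi>" using highest uminus_root by (simp add: highest_root_def)
  ultimately show ?thesis
    by (auto simp: affine_simple_roots_def affine_positive_roots_iff positive_roots_def)
qed

lemma nonneg_combinations_embed:
  assumes "v \<in> nonneg_combinations \<Delta>"
  shows "(v, 0) \<in> nonneg_combinations S"
proof -
  obtain c where c: "v = (\<Sum>b\<in>\<Delta>. c b *\<^sub>R b)" "\<forall>b\<in>\<Delta>. 0 \<le> c b"
    using assms unfolding nonneg_combinations_def by blast
  have "(v, 0) = (\<Sum>b\<in>\<Delta>. c b *\<^sub>R (b, 0::real))"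
    by (simp add: c(1) prod_eq_iff fst_sum snd_sum)
  also have "\<dots> \<in> nonneg_combinations S"
    using c(2) by (intro nonneg_combinations_sum nonneg_combinations_scale_base
        finite_affine_simple) (auto simp: affine_simple_roots_def)
  finally show ?thesis .
qed

text \<open>The cone contains \<delta> as the sum of \<delta> - \<rho> and \<rho>. This settles a +
  r\<delta> for positive a. Otherwise r is at least 1 and the root equals (\<delta> - \<rho>) +
  (\<rho> + a) + (r - 1)\<delta>, where \<rho> + a lies in the cone because \<rho> is highest and -
  a is a root.\<close>

lemma P_subset_nonneg_combinations: "P \<subseteq> nonneg_combinations S"
proof
  fix \<gamma> assume \<gamma>: "\<gamma> \<in> P"
  obtain a r where [simp]: "\<gamma> = (a, r)" by fastforce
  have base: "(- \<rho>, 1) \<in> nonneg_combinations S"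
    using nonneg_combinations_scale_base[OF finite_affine_simple, of "(- \<rho>, 1)" 1]
    by (simp add: affine_simple_roots_def)
  have delta: "(0, k) \<in> nonneg_combinations S" if "0 \<le> k" for k
    using nonneg_combinations_scale[OF nonneg_combinations_add[OF base
        nonneg_combinations_embed[OF highest_positive]] that] by simp
  show "\<gamma> \<in> nonneg_combinations S"
  proof (cases "a \<in> positive_roots \<Phi> \<Delta>")
    case True
    then have "(a, 0) + (0, r) \<in> nonneg_combinations S"
      using \<gamma> by (intro nonneg_combinations_add nonneg_combinations_embed delta)
        (auto simp: affine_positive_roots_iff positive_roots_def)
    then show ?thesis by simp
  next
    case False
    then have r: "1 \<le> r" using \<gamma> by (auto simp: affine_positive_roots_iff elim!: Ints_cases)
    have "\<rho> + a \<in> nonneg_combinations \<Delta>"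
      using highest \<gamma> uminus_root[of a]
      by (auto simp: affine_positive_roots_iff highest_root_def)
    then have "((- \<rho>, 1) + (\<rho> + a, 0)) + (0, r - 1) \<in> nonneg_combinations S"
      using r base \<open>\<rho> + a \<in> nonneg_combinations \<Delta>\<close>
      by (intro nonneg_combinations_add[OF nonneg_combinations_add] nonneg_combinations_embed delta) auto
    then show ?thesis by simp
  qed
qed

lemma P_combinationE:
  assumes "\<gamma> \<in> P"
  obtains c where "\<gamma> = (\<Sum>b\<in>S. c b *\<^sub>R b)" "\<And>b. b \<in> S \<Longrightarrow> 0 \<le> c b"
  using assms P_subset_nonneg_combinations unfolding nonneg_combinations_def by blast

text \<open>This is the linear independence of \<open>S\<close>, in the dual form in which it is
  used.\<close>

lemma linear_prescribed_on_simple: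
  fixes f :: "'a \<times> real \<Rightarrow> real"
  shows "\<exists>h :: 'a \<times> real \<Rightarrow> real. linear h \<and> (\<forall>b\<in>S. h b = f b)"
proof -
  have "independent \<Delta>" using simple by (simp add: simple_system_def)
  then obtain g where g: "linear g" "\<forall>x\<in>\<Delta>. g x = f (x, 0)"
    using linear_independent_extend[of \<Delta> "\<lambda>x. f (x, 0)"] by blast
  \<comment> \<open>The values on \<open>\<Delta>\<close> leave the value at \<delta> free; it is
    chosen to correct the contribution \<open>- g \<rho>\<close> at
    \<open>(- \<rho>, 1)\<close>.\<close>
  let ?h = "\<lambda>v. g (fst v) + snd v * (f (- \<rho>, 1) + g \<rho>)"
  have "linear ?h"
    using g(1) by (intro linearI) (auto simp: linear_add[OF g(1)] linear_scale[OF g(1)] algebra_simps)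
  moreover have "?h b = f b" if "b \<in> S" for b
    using that g by (auto simp: affine_simple_roots_def linear_neg[OF g(1)])
  ultimately show ?thesis by (intro exI[of _ ?h]) simp
qed

text \<open>The height, that is, the sum of the coefficients in the simple roots. It separates
  \<open>P\<close> from its negative and measures progress when reflections are decomposed into
  simple ones.\<close>

lemma height_exists:
  "\<exists>h :: 'a \<times> real \<Rightarrow> real. linear h \<and> (\<forall>b\<in>S. h b = 1) \<and> (\<forall>\<gamma>\<in>P. 0 < h \<gamma>)"
proof -
  obtain h :: "'a \<times> real \<Rightarrow> real" where h: "linear h" "\<And>b. b \<in> S \<Longrightarrow> h b = 1"
    using linear_prescribed_on_simple[of "\<lambda>_. 1"] by blast
  have "0 < h \<gamma>" if \<gamma>: "\<gamma> \<in> P" for \<gamma>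
  proof -
    obtain c where c: "\<gamma> = (\<Sum>b\<in>S. c b *\<^sub>R b)" "\<And>b. b \<in> S \<Longrightarrow> 0 \<le> c b"
      using P_combinationE[OF \<gamma>] by blast
    have hs: "h \<gamma> = sum c S"
      using h by (simp add: c(1) linear_sum[OF h(1)] linear_scale[OF h(1)])
    have "\<gamma> \<noteq> 0" using \<gamma> fst_root_nonzero[of \<gamma>] P_subset_R by auto
    then have "\<not> (\<forall>b\<in>S. c b = 0)"
      using c(1) by (metis (no_types, lifting) scaleR_zero_left sum.neutral)
    then have "sum c S \<noteq> 0"
      using c finite_affine_simple by (simp add: sum_nonneg_eq_0_iff)
    moreover have "0 \<le> sum c S" using c by (simp add: sum_nonneg)
    ultimately show ?thesis using hs by simp
  qed
  with h show ?thesis by blast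
qed

text \<open>A nonnegative combination of elements of \<open>P\<close> has nonnegative height, so its
  opposite cannot be a positive root.\<close>

lemma half_system_P: "half_system R P"
proof -
  obtain h :: "'a \<times> real \<Rightarrow> real"
    where h: "linear h" "\<And>b. b \<in> S \<Longrightarrow> h b = 1" "\<And>\<gamma>. \<gamma> \<in> P \<Longrightarrow> 0 < h \<gamma>"
    using height_exists by blast
  have closed: "j *\<^sub>R \<alpha> + k *\<^sub>R \<beta> \<in> P"
    if "\<alpha> \<in> P" "\<beta> \<in> P" "0 \<le> j" "0 \<le> k" "j *\<^sub>R \<alpha> + k *\<^sub>R \<beta> \<in> R" for \<alpha> \<beta> j k
  proof (rule ccontr)
    assume "j *\<^sub>R \<alpha> + k *\<^sub>R \<beta> \<notin> P"
    then have "0 < h (- (j *\<^sub>R \<alpha> + k *\<^sub>R \<beta>))" using uminus_P_iff[OF that(5)] h(3) by blast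
    also have "\<dots> = - (j * h \<alpha> + k * h \<beta>)"
      by (simp only: linear_neg[OF h(1)] linear_add[OF h(1)] linear_scale[OF h(1)] real_scaleR_def)
    finally have "j * h \<alpha> + k * h \<beta> < 0" by linarith
    moreover have "0 \<le> j * h \<alpha>" "0 \<le> k * h \<beta>" using that h(3) by (simp_all add: less_imp_le)
    ultimately show False by linarith
  qed
  show ?thesis by (rule half_systemI) (fact P_subset_R uminus_P_iff closed)+
qed

text \<open>A functional that vanishes at \<open>\<alpha>\<close> and is 1 at the other simple roots
  is unchanged by the reflection and nonnegative on \<open>P\<close>. If the image of
  \<open>\<gamma>\<close> were negative, the functional would vanish at \<open>\<gamma>\<close>,
  which would then be a multiple of \<open>\<alpha>\<close>, hence
  \<open>- \<alpha>\<close>.\<close>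

lemma simple_reflection_positive:
  assumes "\<alpha> \<in> S" "\<gamma> \<in> P" "\<gamma> \<noteq> \<alpha>"
  shows "affine_reflection \<alpha> \<gamma> \<in> P"
proof (rule ccontr)
  assume neg: "affine_reflection \<alpha> \<gamma> \<notin> P"
  obtain h :: "'a \<times> real \<Rightarrow> real"
    where h: "linear h" "\<And>b. b \<in> S \<Longrightarrow> h b = (if b = \<alpha> then 0 else 1)"
    using linear_prescribed_on_simple[of "\<lambda>b. if b = \<alpha> then 0 else 1"] by blast
  have h_nonneg: "0 \<le> h \<beta>" if \<beta>: "\<beta> \<in> P" for \<beta>
  proof -
    obtain c where c: "\<beta> = (\<Sum>b\<in>S. c b *\<^sub>R b)" "\<And>b. b \<in> S \<Longrightarrow> 0 \<le> c b"
      using P_combinationE[OF \<beta>] by blast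
    show ?thesis using c(2) h by (simp add: c(1) linear_sum[OF h(1)] linear_scale[OF h(1)] sum_nonneg)
  qed
  have R: "\<alpha> \<in> R" "\<gamma> \<in> R" using assms affine_simple_subset_P P_subset_R by auto
  have "- affine_reflection \<alpha> \<gamma> \<in> P"
    using neg R affine_reflection_root uminus_P_iff by blast
  then have "h (affine_reflection \<alpha> \<gamma>) \<le> 0"
    using h_nonneg h(1) by (fastforce simp: linear_neg[OF h(1)])
  then have h0: "h \<gamma> \<le> 0"
    using h assms(1) by (simp add: affine_reflection_def linear_diff[OF h(1)] linear_scale[OF h(1)])
  obtain c where c: "\<gamma> = (\<Sum>b\<in>S. c b *\<^sub>R b)" "\<And>b. b \<in> S \<Longrightarrow> 0 \<le> c b"
    using P_combinationE[OF assms(2)] by blast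
  have "h \<gamma> = (\<Sum>b\<in>S. if b = \<alpha> then 0 else c b)"
    unfolding c(1) using h by (auto simp: linear_sum[OF h(1)] linear_scale[OF h(1)] intro!: sum.cong)
  then have "(\<Sum>b\<in>S. if b = \<alpha> then 0 else c b) = 0"
    using h0 c(2) by (smt (verit) sum_nonneg)
  then have "\<forall>b\<in>S. (if b = \<alpha> then 0 else c b) = 0"
    using c(2) finite_affine_simple by (subst (asm) sum_nonneg_eq_0_iff) auto
  then have "\<gamma> = (\<Sum>b\<in>S. if b = \<alpha> then c \<alpha> *\<^sub>R \<alpha> else 0)"
    unfolding c(1) by (intro sum.cong) (auto split: if_splits)
  then have "\<gamma> = c \<alpha> *\<^sub>R \<alpha>" using assms(1) finite_affine_simple by simp
  then have "\<gamma> = - \<alpha>" using affine_root_multiples[OF R(1)] R(2) assms(3) by metis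
  then show False using assms affine_simple_subset_P uminus_P_iff[OF R(1)] by auto
qed

section \<open>Symmetries of the affine roots and words in the simple reflections\<close>

definition symmetry :: "('a \<times> real \<Rightarrow> 'a \<times> real) \<Rightarrow> bool" where
  "symmetry w \<longleftrightarrow> linear w \<and> bij w \<and>
     (\<forall>u v. affine_form (w u) (w v) = affine_form u v) \<and> w ` R = R"

lemma symmetry_comp:
  assumes "symmetry v" "symmetry w"
  shows "symmetry (v \<circ> w)"
proof -
  have "(v \<circ> w) ` R = R" using assms by (simp only: symmetry_def image_comp[symmetric])
  then show ?thesis
    using assms linear_compose[of w v] bij_comp[of w v] by (simp add: symmetry_def del: split_paired_All)
qed

lemma symmetry_id: "symmetry id"
  by (simp add: symmetry_def linear_id)

lemma reflection_comp_self: "\<gamma> \<in> R \<Longrightarrow> affine_reflection \<gamma> \<circ> affine_reflection \<gamma> = id"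
  by (auto simp: fun_eq_iff affine_reflection_involution fst_root_nonzero)

lemma symmetry_reflection:
  assumes "\<gamma> \<in> R"
  shows "symmetry (affine_reflection \<gamma>)"
proof -
  have "affine_reflection \<gamma> ` R \<subseteq> R" using assms affine_reflection_root by blast
  moreover have "\<beta> \<in> affine_reflection \<gamma> ` R" if "\<beta> \<in> R" for \<beta>
    using affine_reflection_root[OF assms that]
      affine_reflection_involution[OF fst_root_nonzero[OF assms], of \<beta>] by (metis imageI)
  \<comment> \<open>Bijectivity is a separate matter: a linear map that preserves the degenerate
    form may still kill \<delta>.\<close>
  moreover have "bij (affine_reflection \<gamma>)"
    using assms by (intro o_bij[of "affine_reflection \<gamma>"] reflection_comp_self)
  ultimately show ?thesis
    unfolding symmetry_def using linear_affine_reflection affine_form_reflection by blast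
qed

lemma symmetry_root_iff: "symmetry w \<Longrightarrow> w \<gamma> \<in> R \<longleftrightarrow> \<gamma> \<in> R"
  unfolding symmetry_def using bij_is_inj inj_image_mem_iff by metis

lemma symmetry_uminus: "symmetry w \<Longrightarrow> w (- \<gamma>) = - w \<gamma>"
  unfolding symmetry_def by (blast intro: linear_neg)

lemma symmetry_reflection_conj:
  "symmetry w \<Longrightarrow> affine_reflection (w \<gamma>) \<circ> w = w \<circ> affine_reflection \<gamma>"
  unfolding symmetry_def using affine_reflection_conj by blast

definition simple_word :: "('a \<times> real \<Rightarrow> 'a \<times> real) list \<Rightarrow> bool" where
  "simple_word ss \<longleftrightarrow> set ss \<subseteq> affine_reflection ` S"

definition word_prod :: "('a \<times> real \<Rightarrow> 'a \<times> real) list \<Rightarrow> 'a \<times> real \<Rightarrow> 'a \<times> real" where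
  "word_prod ss = foldr (\<circ>) ss id"

lemma simple_word_simps [simp]:
  "simple_word []"
  "simple_word (s # ss) \<longleftrightarrow> s \<in> affine_reflection ` S \<and> simple_word ss"
  "simple_word (ss @ ts) \<longleftrightarrow> simple_word ss \<and> simple_word ts"
  by (auto simp: simple_word_def)

lemma word_prod_simps [simp]:
  "word_prod [] = id"
  "word_prod (s # ss) = s \<circ> word_prod ss"
  "word_prod (ss @ ts) = word_prod ss \<circ> word_prod ts"
proof -
  show 1: "word_prod [] = id" "word_prod (s # ss) = s \<circ> word_prod ss" for s ss
    by (simp_all add: word_prod_def)
  show "word_prod (ss @ ts) = word_prod ss \<circ> word_prod ts"
    by (induction ss) (simp_all only: append.simps 1 o_assoc id_comp)
qed

lemma S_subset_R: "S \<subseteq> R"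
  using affine_simple_subset_P P_subset_R by blast

lemma symmetry_word_prod: "simple_word ss \<Longrightarrow> symmetry (word_prod ss)"
proof (induction ss)
  case Nil
  show ?case by (simp only: word_prod_simps symmetry_id)
next
  case (Cons s ss)
  then have "symmetry s" using S_subset_R symmetry_reflection by auto
  then show ?case unfolding word_prod_simps using Cons by (intro symmetry_comp) auto
qed

text \<open>Induction on a bound for the height. As \<open>\<gamma>\<close> has positive norm, it
  has a positive product with some simple \<open>\<alpha>\<close> of its expansion. If
  \<open>\<gamma>\<close> is not simple, its mirror image \<open>\<beta>\<close> in
  \<open>\<alpha>\<close> is a positive root of smaller height, and conjugating the word for
  \<open>\<beta>\<close> gives one for \<open>\<gamma>\<close>.\<close>

lemma reflection_is_word:
  assumes "\<gamma> \<in> P"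
  shows "\<exists>ss. simple_word ss \<and> affine_reflection \<gamma> = word_prod ss"
proof -
  obtain h :: "'a \<times> real \<Rightarrow> real"
    where h: "linear h" "\<And>b. b \<in> S \<Longrightarrow> h b = 1" "\<And>\<gamma>. \<gamma> \<in> P \<Longrightarrow> 0 < h \<gamma>"
    using height_exists by blast
  have "\<exists>ss. simple_word ss \<and> affine_reflection \<gamma> = word_prod ss"
    if "\<gamma> \<in> P" "h \<gamma> < real n" for n \<gamma>
    using that
  proof (induction n arbitrary: \<gamma>)
    case 0
    then show ?case using h(3)[of \<gamma>] by simp
  next
    case (Suc n)
    show ?case
    proof (cases "\<gamma> \<in> S")
      case True
      then show ?thesis by (intro exI[of _ "[affine_reflection \<gamma>]"]) auto
    next
      case False
      obtain c where c: "\<gamma> = (\<Sum>b\<in>S. c b *\<^sub>R b)" "\<And>b. b \<in> S \<Longrightarrow> 0 \<le> c b"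
        using P_combinationE[OF Suc.prems(1)] by blast
      have "fst \<gamma> \<noteq> 0" using Suc.prems P_subset_R fst_root_nonzero by blast
      then have "0 < affine_form \<gamma> \<gamma>" by (simp add: affine_form_def)
      also have "affine_form \<gamma> \<gamma> = (\<Sum>b\<in>S. c b * affine_form \<gamma> b)"
        by (subst (2) c(1)) (simp add: affine_form_def fst_sum inner_sum_right)
      finally obtain \<alpha> where \<alpha>: "\<alpha> \<in> S" "0 < c \<alpha> * affine_form \<gamma> \<alpha>"
        by (meson not_less sum_nonpos)
      define k where "k = 2 * affine_form \<gamma> \<alpha> / affine_form \<alpha> \<alpha>"
      have R: "\<alpha> \<in> R" "\<gamma> \<in> R" using \<alpha>(1) S_subset_R Suc.prems P_subset_R by auto
      have "0 < affine_form \<gamma> \<alpha>" using \<alpha> c(2) by (smt (verit) mult_nonneg_nonpos)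
      then have "0 < k" using fst_root_nonzero[OF R(1)] by (simp add: k_def affine_form_def)
      \<comment> \<open>Integrality turns positivity of \<open>k\<close> into
        \<open>1 \<le> k\<close>, so that the bound \<open>n\<close> can drop by one.\<close>
      moreover have "k \<in> \<int>"
        using cartan_integer R by (simp add: k_def affine_form_def affine_roots_iff)
      ultimately have "1 \<le> k" by (auto elim!: Ints_cases)
      define \<beta> where "\<beta> = affine_reflection \<alpha> \<gamma>"
      have "\<beta> \<in> P"
        unfolding \<beta>_def using False \<alpha>(1) Suc.prems by (intro simple_reflection_positive) auto
      moreover have "h \<beta> = h \<gamma> - k"
        using h \<alpha>(1) by (simp add: \<beta>_def affine_reflection_def k_def linear_diff[OF h(1)] linear_scale[OF h(1)])
      ultimately obtain ss where ss: "simple_word ss" "affine_reflection \<beta> = word_prod ss"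
        using Suc.IH[of \<beta>] Suc.prems \<open>1 \<le> k\<close> by auto
      let ?s = "affine_reflection \<alpha>"
      have "affine_reflection \<gamma> = ?s \<circ> (?s \<circ> affine_reflection \<gamma>)"
        by (simp add: o_assoc reflection_comp_self[OF R(1)])
      also have "\<dots> = ?s \<circ> (affine_reflection \<beta> \<circ> ?s)"
        using symmetry_reflection_conj[OF symmetry_reflection[OF R(1)], of \<gamma>] by (simp add: \<beta>_def)
      also have "\<dots> = word_prod ([?s] @ ss @ [?s])"
        by (simp add: ss o_assoc)
      finally show ?thesis using ss \<alpha> by (intro exI[of _ "[?s] @ ss @ [?s]"]) auto
    qed
  qed
  from this[OF assms, of "nat \<lceil>h \<gamma>\<rceil> + 1"] show ?thesis by (smt (verit) of_nat_1 of_nat_add real_nat_ceiling_ge)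
qed

lemma root_reflection_is_word:
  assumes "\<gamma> \<in> R"
  shows "\<exists>ss. simple_word ss \<and> affine_reflection \<gamma> = word_prod ss"
  using assms reflection_is_word[of \<gamma>] reflection_is_word[of "- \<gamma>"] uminus_P_iff[of \<gamma>]
  by (auto simp: affine_reflection_uminus)

lemma affine_weyl_group_word:
  assumes "w \<in> affine_weyl_group \<Phi> \<Delta>"
  shows "\<exists>ss. simple_word ss \<and> w = word_prod ss"
proof -
  have bij: "affine_reflection \<gamma> \<in> Bij UNIV" if "\<gamma> \<in> R" for \<gamma>
    using symmetry_reflection[OF that] by (auto simp: Bij_def symmetry_def)
  \<comment> \<open>Multiplication in \<open>BijGroup\<close> agrees with composition only on
    members of \<open>Bij UNIV\<close>, so bijectivity of the words is needed below.\<close>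
  have Bij_word: "word_prod ss \<in> Bij UNIV" if "simple_word ss" for ss
    using symmetry_word_prod[OF that] by (auto simp: Bij_def symmetry_def)
  show ?thesis
    using assms unfolding affine_weyl_group_def
  proof (induction rule: generate.induct)
    case one
    then show ?case by (intro exI[of _ "[]"]) (auto simp: BijGroup_def)
  next
    case (incl w)
    then show ?case using root_reflection_is_word by blast
  next
    case (inv w)
    then obtain \<gamma> where \<gamma>: "\<gamma> \<in> R" "w = affine_reflection \<gamma>" by blast
    have "inv\<^bsub>BijGroup UNIV\<^esub> w = inv_into UNIV w"
      using bij \<gamma> by (simp only: inv_BijGroup restrict_UNIV)
    also have "\<dots> = w"
      unfolding \<gamma>(2) by (rule inv_unique_comp) (simp_all add: reflection_comp_self \<gamma>(1))
    finally show ?case using root_reflection_is_word \<gamma> by simp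
  next
    case (eng v w)
    then obtain ss ts where st: "simple_word ss" "v = word_prod ss" "simple_word ts" "w = word_prod ts"
      by blast
    have "v \<otimes>\<^bsub>BijGroup UNIV\<^esub> w = v \<circ> w"
      using Bij_word[OF st(1)] Bij_word[OF st(3)] unfolding st(2,4)
      by (simp add: BijGroup_def compose_def fun_eq_iff)
    then show ?case using st by (intro exI[of _ "ss @ ts"]) simp
  qed
qed

subsection \<open>Length and inversions\<close>

text \<open>This is N(w^-1), the set that enters the twisted length, written without an
  inverse.\<close>

definition inversions :: "('a \<times> real \<Rightarrow> 'a \<times> real) \<Rightarrow> ('a \<times> real) set" where
  "inversions w = {\<gamma> \<in> P. w \<gamma> \<notin> P}"

lemma inversion_set_inv:
  assumes "symmetry w"
  shows "inversion_set \<Phi> \<Delta> (inv_into UNIV w) = inversions w"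
proof -
  have "bij w" using assms by (simp add: symmetry_def)
  then have "inv_into UNIV (inv_into UNIV w) = w" by (rule inv_inv_eq)
  moreover have "w \<gamma> \<in> uminus ` P \<longleftrightarrow> w \<gamma> \<notin> P" if "\<gamma> \<in> P" for \<gamma>
    using that assms symmetry_root_iff P_subset_R mem_uminus_P_iff by blast
  ultimately show ?thesis unfolding inversion_set_def inversions_def by auto
qed

text \<open>The reflection permutes the positive roots other than \<open>\<alpha>\<close> and so
  transports their inversions. At \<open>\<alpha>\<close> the composite takes the value
  \<open>- w \<alpha>\<close>, which decides whether \<open>\<alpha>\<close> is an
  inversion.\<close>

lemma inversions_simple_reflection:
  assumes w: "symmetry w" and \<alpha>: "\<alpha> \<in> S"
  shows "inversions (w \<circ> affine_reflection \<alpha>) =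
    affine_reflection \<alpha> ` (inversions w - {\<alpha>}) \<union> (if w \<alpha> \<in> P then {\<alpha>} else {})"
proof -
  let ?s = "affine_reflection \<alpha>"
  have R: "\<alpha> \<in> R" using \<alpha> S_subset_R by blast
  have \<alpha>P: "\<alpha> \<in> P" using \<alpha> affine_simple_subset_P by blast
  have ss: "?s (?s v) = v" for v using R affine_reflection_involution fst_root_nonzero by blast
  have s\<alpha>: "?s \<alpha> = - \<alpha>" using R affine_reflection_self fst_root_nonzero by blast
  have other: "\<gamma> \<in> inversions (w \<circ> ?s) \<longleftrightarrow> \<gamma> \<in> ?s ` (inversions w - {\<alpha>})"
    if "\<gamma> \<noteq> \<alpha>" for \<gamma>
  proof -
    have "\<gamma> \<in> ?s ` (inversions w - {\<alpha>}) \<longleftrightarrow> ?s \<gamma> \<in> inversions w - {\<alpha>}"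
      by (metis (no_types, lifting) image_iff ss)
    moreover have "?s \<gamma> \<noteq> \<alpha>" if "\<gamma> \<in> P"
    proof
      assume "?s \<gamma> = \<alpha>"
      then have "\<gamma> = - \<alpha>" using ss s\<alpha> by metis
      then show False using that \<alpha>P uminus_P_iff[OF R] by blast
    qed
    moreover have "?s \<gamma> \<in> P" if "\<gamma> \<in> P"
      using that \<open>\<gamma> \<noteq> \<alpha>\<close> \<alpha> simple_reflection_positive by blast
    moreover have "\<gamma> \<in> P" if "?s \<gamma> \<in> P" "?s \<gamma> \<noteq> \<alpha>"
      using that \<alpha> simple_reflection_positive ss by metis
    ultimately show ?thesis unfolding inversions_def by auto
  qed
  have at: "\<alpha> \<in> inversions (w \<circ> ?s) \<longleftrightarrow> w \<alpha> \<in> P"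
    using \<alpha>P s\<alpha> w R symmetry_uminus symmetry_root_iff uminus_P_iff[of "w \<alpha>"]
    by (auto simp: inversions_def)
  have notin: "\<alpha> \<notin> ?s ` (inversions w - {\<alpha>})"
  proof
    assume "\<alpha> \<in> ?s ` (inversions w - {\<alpha>})"
    then have "- \<alpha> \<in> P" using s\<alpha> ss by (metis (no_types, lifting) DiffD1 imageE inversions_def mem_Collect_eq)
    then show False using uminus_P_iff[OF R] \<alpha>P by blast
  qed
  show ?thesis
  proof (rule Set.set_eqI)
    fix \<gamma>
    show "\<gamma> \<in> inversions (w \<circ> ?s) \<longleftrightarrow>
        \<gamma> \<in> ?s ` (inversions w - {\<alpha>}) \<union> (if w \<alpha> \<in> P then {\<alpha>} else {})"
    proof (cases "\<gamma> = \<alpha>")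
      case True
      then show ?thesis using at notin by simp
    next
      case False
      then show ?thesis using other[OF False] by simp
    qed
  qed
qed

section \<open>Reduced words and the exchange condition\<close>

lemma finite_inversions_word: "simple_word ss \<Longrightarrow> finite (inversions (word_prod ss))"
proof (induction ss rule: rev_induct)
  case Nil
  then show ?case by (simp add: inversions_def)
next
  case (snoc s ss)
  then obtain \<alpha> where "\<alpha> \<in> S" "s = affine_reflection \<alpha>" by auto
  moreover have "symmetry (word_prod ss)" "finite (inversions (word_prod ss))"
    using snoc symmetry_word_prod by auto
  ultimately show ?case
    unfolding word_prod_simps o_id by (simp only: inversions_simple_reflection) simp
qed

lemma card_inversions_ascent:
  assumes "symmetry w" "finite (inversions w)" "\<alpha> \<in> S" "w \<alpha> \<in> P"
  shows "card (inversions (w \<circ> affine_reflection \<alpha>)) = card (inversions w) + 1"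
proof -
  have \<alpha>: "\<alpha> \<notin> inversions w" using assms by (simp add: inversions_def)
  have "\<alpha> \<notin> affine_reflection \<alpha> ` inversions w"
  proof
    assume "\<alpha> \<in> affine_reflection \<alpha> ` inversions w"
    then obtain \<beta> where "\<beta> \<in> inversions w" "\<alpha> = affine_reflection \<alpha> \<beta>" by blast
    moreover have R: "\<alpha> \<in> R" using assms S_subset_R by blast
    ultimately have "- \<alpha> \<in> P"
      using affine_reflection_involution[OF fst_root_nonzero] affine_reflection_self[OF fst_root_nonzero]
      by (metis (no_types, lifting) inversions_def mem_Collect_eq)
    then show False using uminus_P_iff[OF R] assms affine_simple_subset_P by blast
  qed
  moreover have "inj (affine_reflection \<alpha>)"
    using symmetry_reflection[of \<alpha>] assms S_subset_R by (auto simp: symmetry_def bij_is_inj)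
  ultimately show ?thesis
    using \<alpha> assms by (simp add: inversions_simple_reflection card_image inj_on_subset)
qed

text \<open>Apply the letters to \<open>\<alpha>\<close> from the right. The first letter to make
  the image negative is the reflection in the simple root \<open>\<beta>\<close> reached just before
  it. By conjugation this letter can be deleted at the price of a final reflection in
  \<open>\<alpha>\<close>.\<close>

lemma exchange:
  assumes "simple_word ss" "\<alpha> \<in> S" "word_prod ss \<alpha> \<notin> P"
  shows "\<exists>ts. simple_word ts \<and> length ts + 1 = length ss \<and>
           word_prod ss = word_prod ts \<circ> affine_reflection \<alpha>"
  using assms
proof (induction ss)
  case Nil
  then show ?case using affine_simple_subset_P by auto
next
  case (Cons s ss)
  then obtain \<beta> where \<beta>: "\<beta> \<in> S" "s = affine_reflection \<beta>" by auto
  have sw: "simple_word ss" using Cons.prems by simp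
  show ?case
  proof (cases "word_prod ss \<alpha> \<in> P")
    case True
    then have "word_prod ss \<alpha> = \<beta>"
      using simple_reflection_positive[OF \<beta>(1) True] Cons.prems \<beta>(2) by auto
    then have "s \<circ> word_prod ss = word_prod ss \<circ> affine_reflection \<alpha>"
      using symmetry_reflection_conj[OF symmetry_word_prod[OF sw], of \<alpha>] \<beta> by simp
    then show ?thesis using sw by (intro exI[of _ ss]) simp
  next
    case False
    then obtain ts where "simple_word ts" "length ts + 1 = length ss"
      "word_prod ss = word_prod ts \<circ> affine_reflection \<alpha>"
      using Cons sw by blast
    then show ?thesis
      using Cons.prems by (intro exI[of _ "s # ts"]) (simp add: o_assoc)
  qed
qed

text \<open>Letters are appended on the right. An ascent adds one inversion; at a descent the
  exchange condition lets the new letter cancel, which leaves a word shorter by two.\<close>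

lemma reduced_or_shorter_word:
  assumes "simple_word ss"
  shows "card (inversions (word_prod ss)) = length ss \<or>
    (\<exists>ts. simple_word ts \<and> length ts < length ss \<and> word_prod ts = word_prod ss)"
  using assms
proof (induction ss rule: rev_induct)
  case Nil
  then show ?case by (simp add: inversions_def)
next
  case (snoc s ss)
  then obtain \<alpha> where \<alpha>: "\<alpha> \<in> S" "s = affine_reflection \<alpha>" by auto
  have sw: "simple_word ss" using snoc by simp
  have prod: "word_prod (ss @ [s]) = word_prod ss \<circ> s" by simp
  consider (shorter) ts where "simple_word ts" "length ts < length ss" "word_prod ts = word_prod ss"
    | (up) "card (inversions (word_prod ss)) = length ss" "word_prod ss \<alpha> \<in> P"
    | (down) "word_prod ss \<alpha> \<notin> P"
    using snoc.IH[OF sw] by blast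
  then show ?case
  proof cases
    case shorter
    then show ?thesis
      using snoc.prems by (intro disjI2 exI[of _ "ts @ [s]"]) simp
  next
    case up
    then show ?thesis
      using card_inversions_ascent[OF symmetry_word_prod[OF sw] finite_inversions_word[OF sw] \<alpha>(1)]
      unfolding prod using \<alpha>(2) by (intro disjI1) (simp del: o_apply comp_apply)
  next
    case down
    then obtain ts where ts: "simple_word ts" "length ts + 1 = length ss"
      "word_prod ss = word_prod ts \<circ> s"
      using exchange[OF sw \<alpha>(1)] \<alpha>(2) by blast
    then have "word_prod (ss @ [s]) = word_prod ts"
      unfolding prod using \<alpha> S_subset_R by (auto simp: o_assoc[symmetric] reflection_comp_self)
    then show ?thesis using ts by (intro disjI2 exI[of _ ts]) simp
  qed
qed

text \<open>A word of minimal length admits no shorter one, so its length is its number of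
  inversions.\<close>

lemma affine_length_eq_card_inversions:
  assumes "simple_word ss"
  shows "affine_length \<Delta> \<rho> (word_prod ss) = card (inversions (word_prod ss))"
proof -
  define n where "n = affine_length \<Delta> \<rho> (word_prod ss)"
  let ?Q = "\<lambda>n. \<exists>ts. simple_word ts \<and> length ts = n \<and> word_prod ss = word_prod ts"
  have n: "n = (LEAST n. ?Q n)" by (simp add: n_def affine_length_def simple_word_def word_prod_def)
  have "?Q n" unfolding n by (rule LeastI[of ?Q "length ss"]) (use assms in blast)
  then obtain ts where ts: "simple_word ts" "length ts = n" "word_prod ss = word_prod ts" by blast
  have "\<not> ?Q m" if "m < n" for m using that not_less_Least n by blast
  then have "card (inversions (word_prod ts)) = n"
    using reduced_or_shorter_word[OF ts(1)] ts by metis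
  then show ?thesis using ts n_def by simp
qed

subsection \<open>Twisted length and upper covers\<close>

definition twisted_positive :: "('a \<times> real) set \<Rightarrow> ('a \<times> real) set" where
  "twisted_positive B = (P - B) \<union> uminus ` B"

text \<open>The case to check is \<open>\<gamma> = j *\<^sub>R \<alpha> - k *\<^sub>R b\<close> with
  \<open>\<alpha>\<close> in \<open>P - B\<close> and \<open>b\<close> in \<open>B\<close>. If
  \<open>\<gamma>\<close> were in \<open>B\<close>, solving for \<open>\<alpha>\<close> would put
  \<open>\<alpha>\<close> into \<open>B\<close>; if \<open>- \<gamma>\<close> were in
  \<open>P - B\<close>, solving for \<open>b\<close> would put \<open>b\<close> into
  \<open>P - B\<close>.\<close>

lemma half_system_twisted_positive:
  assumes B: "biclosed \<Phi> \<Delta> B"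
  shows "half_system R (twisted_positive B)"
proof -
  have BP: "B \<subseteq> P"
    and cB: "\<And>\<alpha> \<beta> j k. \<alpha> \<in> B \<Longrightarrow> \<beta> \<in> B \<Longrightarrow> 0 \<le> j \<Longrightarrow> 0 \<le> k \<Longrightarrow> j *\<^sub>R \<alpha> + k *\<^sub>R \<beta> \<in> R \<Longrightarrow>
      j *\<^sub>R \<alpha> + k *\<^sub>R \<beta> \<in> B"
    and cC: "\<And>\<alpha> \<beta> j k. \<alpha> \<in> P - B \<Longrightarrow> \<beta> \<in> P - B \<Longrightarrow> 0 \<le> j \<Longrightarrow> 0 \<le> k \<Longrightarrow> j *\<^sub>R \<alpha> + k *\<^sub>R \<beta> \<in> R \<Longrightarrow>
      j *\<^sub>R \<alpha> + k *\<^sub>R \<beta> \<in> P - B"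
    using B unfolding biclosed_def closed_roots_def by (blast, blast, blast)
  let ?H = "twisted_positive B"
  have mem: "\<gamma> \<in> ?H \<longleftrightarrow> \<gamma> \<in> P - B \<or> - \<gamma> \<in> B" for \<gamma>
    unfolding twisted_positive_def by force
  obtain h :: "'a \<times> real \<Rightarrow> real"
    where h: "linear h" "\<And>b. b \<in> S \<Longrightarrow> h b = 1" "\<And>\<gamma>. \<gamma> \<in> P \<Longrightarrow> 0 < h \<gamma>"
    using height_exists by blast
  \<comment> \<open>This handles \<open>j = 0\<close> and \<open>k = 0\<close> in the mixed case,
    where one cannot divide.\<close>
  have no_neg: "- (k *\<^sub>R b) \<notin> P" if "b \<in> P" "0 \<le> k" for k b
    using h(3)[of "- (k *\<^sub>R b)"] h(3)[OF that(1)] that(2) h(1)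
    by (auto simp: linear_neg[OF h(1)] linear_scale[OF h(1)] mult_less_0_iff)
  have mixed: "j *\<^sub>R \<alpha> - k *\<^sub>R b \<in> ?H"
    if \<alpha>: "\<alpha> \<in> P - B" and b: "b \<in> B" and jk: "0 \<le> j" "0 \<le> k" and R: "j *\<^sub>R \<alpha> - k *\<^sub>R b \<in> R"
    for \<alpha> b j k
  proof (rule ccontr)
    define \<gamma> where "\<gamma> = j *\<^sub>R \<alpha> - k *\<^sub>R b"
    assume "j *\<^sub>R \<alpha> - k *\<^sub>R b \<notin> ?H"
    then consider "\<gamma> \<in> B" | "- \<gamma> \<in> P - B"
      using R uminus_P_iff mem BP unfolding \<gamma>_def by blast
    then show False
    proof cases
      case 1
      show False
      proof (cases "j = 0")
        case True
        then show False using 1 no_neg[of b k] b jk BP by (auto simp: \<gamma>_def)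
      next
        case False
        then have "\<alpha> = (1 / j) *\<^sub>R \<gamma> + (k / j) *\<^sub>R b"
          by (simp add: \<gamma>_def scaleR_diff_right)
        then show False using cB[OF 1 b, of "1 / j" "k / j"] jk \<alpha> P_subset_R by auto
      qed
    next
      case 2
      show False
      proof (cases "k = 0")
        case True
        then show False using 2 no_neg[of \<alpha> j] \<alpha> jk by (auto simp: \<gamma>_def)
      next
        case False
        then have "b = (1 / k) *\<^sub>R (- \<gamma>) + (j / k) *\<^sub>R \<alpha>"
          by (simp add: \<gamma>_def scaleR_diff_right)
        then show False using cC[OF 2 \<alpha>, of "1 / k" "j / k"] jk b P_subset_R BP by auto
      qed
    qed
  qed
  have closed: "j *\<^sub>R \<alpha> + k *\<^sub>R \<beta> \<in> ?H"
    if ab: "\<alpha> \<in> ?H" "\<beta> \<in> ?H" and jk: "0 \<le> j" "0 \<le> k" and R: "j *\<^sub>R \<alpha> + k *\<^sub>R \<beta> \<in> R" for \<alpha> \<beta> j k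
  proof -
    consider "\<alpha> \<in> P - B" "\<beta> \<in> P - B" | "- \<alpha> \<in> B" "- \<beta> \<in> B"
      | "\<alpha> \<in> P - B" "- \<beta> \<in> B" | "- \<alpha> \<in> B" "\<beta> \<in> P - B"
      using ab mem by blast
    then show ?thesis
    proof cases
      case 1
      then show ?thesis using cC jk R mem by blast
    next
      case 2
      have "j *\<^sub>R (- \<alpha>) + k *\<^sub>R (- \<beta>) = - (j *\<^sub>R \<alpha> + k *\<^sub>R \<beta>)" by simp
      then show ?thesis using cB[OF 2 jk] uminus_R[OF R] mem by metis
    next
      case 3
      then show ?thesis using mixed[of \<alpha> "- \<beta>" j k] jk R by simp
    next
      case 4
      then show ?thesis using mixed[of \<beta> "- \<alpha>" k j] jk R by (simp add: add.commute)
    qed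
  qed
  have sub: "?H \<subseteq> R" using P_subset_R uminus_R BP unfolding twisted_positive_def by blast
  have opp: "- \<gamma> \<in> ?H \<longleftrightarrow> \<gamma> \<notin> ?H" if "\<gamma> \<in> R" for \<gamma>
    using uminus_P_iff[OF that] BP unfolding mem by auto
  show ?thesis by (rule half_systemI) (fact sub opp closed)+
qed

text \<open>Applied to \<open>P\<close> this yields the half system u^-1 P without forming an
  inverse.\<close>

lemma half_system_vimage:
  assumes w: "symmetry w" and H: "half_system R H"
  shows "half_system R (w -` H)"
proof -
  have lin: "w (j *\<^sub>R \<alpha> + k *\<^sub>R \<beta>) = j *\<^sub>R w \<alpha> + k *\<^sub>R w \<beta>" for j k \<alpha> \<beta>
    using w unfolding symmetry_def by (metis linear_add linear_scale)
  show ?thesis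
  proof (rule half_systemI)
    show "w -` H \<subseteq> R"
      using symmetry_root_iff[OF w] half_systemD(1)[OF H] by blast
    show "- \<gamma> \<in> w -` H \<longleftrightarrow> \<gamma> \<notin> w -` H" if "\<gamma> \<in> R" for \<gamma>
      using that half_systemD(2)[OF H, of "w \<gamma>"] by (simp add: symmetry_root_iff[OF w] symmetry_uminus[OF w])
    show "j *\<^sub>R \<alpha> + k *\<^sub>R \<beta> \<in> w -` H"
      if "\<alpha> \<in> w -` H" "\<beta> \<in> w -` H" "0 \<le> j" "0 \<le> k" "j *\<^sub>R \<alpha> + k *\<^sub>R \<beta> \<in> R" for \<alpha> \<beta> j k
      using that half_systemD(3)[OF H, of "w \<alpha>" "w \<beta>" j k]
        symmetry_root_iff[OF w, of "j *\<^sub>R \<alpha> + k *\<^sub>R \<beta>"]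
      by (simp add: lin)
  qed
qed

text \<open>Only inversions and their negatives contribute. An inversion \<open>\<gamma>\<close> and
  \<open>- \<gamma>\<close> both give twice the twisted sign of \<open>\<gamma>\<close>, which is -1
  on \<open>B\<close> and 1 elsewhere in \<open>P\<close>; hence the factor 4. The freedom in
  \<open>X\<close> lets two lengths be compared over a common set.\<close>

lemma twisted_length_sum:
  assumes B: "biclosed \<Phi> \<Delta> B" and ss: "simple_word ss" "w = word_prod ss"
    and X: "finite X" "X \<subseteq> R" "uminus ` X = X" "inversions w \<subseteq> X"
  shows "4 * twisted_length \<Phi> \<Delta> \<rho> B w =
    (\<Sum>\<gamma>\<in>X. half_sign (twisted_positive B) \<gamma> * (half_sign P \<gamma> - half_sign P (w \<gamma>)))"
proof -
  have w: "symmetry w" using ss symmetry_word_prod by blast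
  let ?e = "half_sign (twisted_positive B)"
  let ?f = "\<lambda>\<gamma>. ?e \<gamma> * (half_sign P \<gamma> - half_sign P (w \<gamma>))"
  have BP: "B \<subseteq> P" using B by (simp add: biclosed_def)
  have odd: "?f (- \<gamma>) = ?f \<gamma>" if "\<gamma> \<in> R" for \<gamma>
    using that half_sign_uminus[OF half_system_twisted_positive[OF B] that]
      half_sign_uminus[OF half_system_P that]
      half_sign_uminus[OF half_system_P, of "w \<gamma>"] symmetry_root_iff[OF w] symmetry_uminus[OF w]
    by (simp add: algebra_simps)
  have eP: "?e \<gamma> = (if \<gamma> \<in> B then - 1 else 1)" if "\<gamma> \<in> P" for \<gamma>
  proof -
    have "- \<gamma> \<notin> B" using BP uminus_P_iff that P_subset_R by blast
    then show ?thesis using that by (force simp: half_sign_def twisted_positive_def)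
  qed
  have "(\<Sum>\<gamma>\<in>X - P. ?f \<gamma>) = (\<Sum>\<gamma>\<in>X \<inter> P. ?f \<gamma>)"
  proof (rule sum.reindex_bij_witness[of _ uminus uminus])
    fix \<gamma> assume "\<gamma> \<in> X - P"
    then show "- \<gamma> \<in> X \<inter> P" "?f (- \<gamma>) = ?f \<gamma>"
      using X odd uminus_P_iff by blast+
  next
    fix \<gamma> assume "\<gamma> \<in> X \<inter> P"
    then show "- \<gamma> \<in> X - P" using X uminus_P_iff by blast
  qed auto
  then have "(\<Sum>\<gamma>\<in>X. ?f \<gamma>) = 2 * (\<Sum>\<gamma>\<in>X \<inter> P. ?f \<gamma>)"
    using sum.Int_Diff[OF X(1), of ?f P] by simp
  also have "(\<Sum>\<gamma>\<in>X \<inter> P. ?f \<gamma>) = (\<Sum>\<gamma>\<in>inversions w. 2 * ?e \<gamma>)"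
    using X by (intro sum.mono_neutral_cong_right) (auto simp: inversions_def half_sign_def)
  also have "\<dots> = (\<Sum>\<gamma>\<in>inversions w. 2 - 4 * (if \<gamma> \<in> B then 1 else 0))"
    by (intro sum.cong) (auto simp: eP inversions_def)
  also have "\<dots> = 2 * int (card (inversions w)) - 4 * int (card (inversions w \<inter> B))"
    using finite_inversions_word[OF ss(1)] ss(2)
    by (simp add: sum_subtractf sum.If_cases flip: sum_distrib_left)
  finally show ?thesis
    using affine_length_eq_card_inversions[OF ss(1)] inversion_set_inv[OF w] ss(2)
    unfolding twisted_length_def by simp
qed

text \<open>Symmetrising the sum over \<open>\<gamma>\<close> and its mirror image makes every summand a product of two
  differences, which have equal or opposite signs throughout.\<close>

lemma twisted_length_difference:
  assumes B: "biclosed \<Phi> \<Delta> B" and ss: "simple_word ss" "u = word_prod ss"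
    and \<alpha>: "\<alpha> \<in> R" and Y: "finite Y" "Y \<subseteq> R"
  obtains X where "finite X" "X \<subseteq> R" "Y \<subseteq> X" "\<And>\<gamma>. \<gamma> \<in> X \<Longrightarrow> - \<gamma> \<in> X"
    "8 * (twisted_length \<Phi> \<Delta> \<rho> B (u \<circ> affine_reflection \<alpha>) - twisted_length \<Phi> \<Delta> \<rho> B u) =
      (\<Sum>\<gamma>\<in>X. (half_sign (twisted_positive B) \<gamma> - half_sign (twisted_positive B) (affine_reflection \<alpha> \<gamma>)) *
        (half_sign (u -` P) \<gamma> - half_sign (u -` P) (affine_reflection \<alpha> \<gamma>)))"
proof -
  let ?s = "affine_reflection \<alpha>" and ?e = "half_sign (twisted_positive B)"
  let ?t = "half_sign (u -` P)"
  obtain ts where ts: "simple_word ts" "u \<circ> ?s = word_prod ts"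
    using root_reflection_is_word[OF \<alpha>] ss by (metis simple_word_simps(3) word_prod_simps(3))
  \<comment> \<open>The set \<open>X\<close> must contain \<open>Y\<close> and both inversion sets
    and be closed under negation and under the reflection. Closing up in this order works because
    the reflection commutes with negation.\<close>
  define Z where "Z = Y \<union> inversions u \<union> inversions (u \<circ> ?s)"
  define Z' where "Z' = Z \<union> uminus ` Z"
  define X where "X = Z' \<union> ?s ` Z'"
  have s: "symmetry ?s" using \<alpha> symmetry_reflection by blast
  have invol: "?s (?s v) = v" for v using \<alpha> affine_reflection_involution fst_root_nonzero by blast
  have "finite Z"
    using Y finite_inversions_word ss ts by (simp add: Z_def)
  then have finX: "finite X" by (simp add: X_def Z'_def)
  have "Z \<subseteq> R" using Y P_subset_R by (auto simp: Z_def inversions_def)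
  then have "Z' \<subseteq> R" using uminus_R by (auto simp: Z'_def)
  then have XR: "X \<subseteq> R" using symmetry_root_iff[OF s] by (auto simp: X_def)
  have Zm: "- \<gamma> \<in> Z'" if "\<gamma> \<in> Z'" for \<gamma> using that by (auto simp: Z'_def)
  have Xm: "- \<gamma> \<in> X" if "\<gamma> \<in> X" for \<gamma>
    using that Zm symmetry_uminus[OF s, symmetric] unfolding X_def by blast
  have Xs: "?s \<gamma> \<in> X" if "\<gamma> \<in> X" for \<gamma> using that by (auto simp: X_def invol)
  have ZX: "Z \<subseteq> X" by (auto simp: X_def Z'_def)
  have um: "uminus ` X = X" using Xm by (metis image_subsetI minus_minus subsetI subset_antisym image_eqI)
  have reindex: "(\<Sum>\<gamma>\<in>X. f (?s \<gamma>)) = (\<Sum>\<gamma>\<in>X. f \<gamma>)" for f :: "'a \<times> real \<Rightarrow> int"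
    by (rule sum.reindex_bij_witness[of _ ?s ?s]) (auto simp: invol Xs)
  have 1: "4 * twisted_length \<Phi> \<Delta> \<rho> B u = (\<Sum>\<gamma>\<in>X. ?e \<gamma> * (half_sign P \<gamma> - ?t \<gamma>))"
    using twisted_length_sum[OF B ss finX XR um] ZX by (auto simp: Z_def half_sign_def)
  have 2: "4 * twisted_length \<Phi> \<Delta> \<rho> B (u \<circ> ?s) = (\<Sum>\<gamma>\<in>X. ?e \<gamma> * (half_sign P \<gamma> - ?t (?s \<gamma>)))"
    using twisted_length_sum[OF B ts finX XR um] ZX by (auto simp: Z_def half_sign_def)
  \<comment> \<open>Reindexing by the reflection turns the second sum on the right into the first;
    this doubling raises the factor 4 to 8.\<close>
  have "(\<Sum>\<gamma>\<in>X. (?e \<gamma> - ?e (?s \<gamma>)) * (?t \<gamma> - ?t (?s \<gamma>))) =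
      (\<Sum>\<gamma>\<in>X. ?e \<gamma> * (?t \<gamma> - ?t (?s \<gamma>))) + (\<Sum>\<gamma>\<in>X. ?e (?s \<gamma>) * (?t (?s \<gamma>) - ?t (?s (?s \<gamma>))))"
    by (simp add: invol algebra_simps flip: sum.distrib)
  also have "\<dots> = 2 * (\<Sum>\<gamma>\<in>X. ?e \<gamma> * (?t \<gamma> - ?t (?s \<gamma>)))"
    using reindex[of "\<lambda>\<gamma>. ?e \<gamma> * (?t \<gamma> - ?t (?s \<gamma>))"] by simp
  also have "(\<Sum>\<gamma>\<in>X. ?e \<gamma> * (?t \<gamma> - ?t (?s \<gamma>))) =
      4 * twisted_length \<Phi> \<Delta> \<rho> B (u \<circ> ?s) - 4 * twisted_length \<Phi> \<Delta> \<rho> B u"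
    unfolding 1 2 by (simp add: algebra_simps flip: sum_subtractf)
  finally show ?thesis
    using that[of X] finX XR Xm ZX by (auto simp: Z_def)
qed

text \<open>Otherwise \<open>- \<alpha>\<close> lies in u^-1 P, and all summands of the length
  difference are at most 0, although their sum is 8.\<close>

lemma twisted_cover_positive:
  assumes B: "biclosed \<Phi> \<Delta> B" and ss: "simple_word ss" "u = word_prod ss"
    and \<alpha>: "\<alpha> \<in> twisted_positive B"
    and cover: "twisted_length \<Phi> \<Delta> \<rho> B (u \<circ> affine_reflection \<alpha>) = twisted_length \<Phi> \<Delta> \<rho> B u + 1"
  shows "u \<alpha> \<in> P"
proof (rule ccontr)
  assume "u \<alpha> \<notin> P"
  have u: "symmetry u" using ss symmetry_word_prod by blast
  have H: "half_system R (twisted_positive B)" using B by (rule half_system_twisted_positive)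
  have K: "half_system R (u -` P)" using u half_system_P by (rule half_system_vimage)
  have R: "\<alpha> \<in> R" using H \<alpha> by (auto dest: half_systemD)
  then have "- \<alpha> \<in> u -` P"
    using \<open>u \<alpha> \<notin> P\<close> K by (auto dest: half_systemD)
  note nonpos = half_sign_reflection_mult_nonpos[OF H K \<alpha> this]
  let ?s = "affine_reflection \<alpha>" and ?e = "half_sign (twisted_positive B)"
  let ?t = "half_sign (u -` P)"
  obtain X where X: "X \<subseteq> R"
    "8 * (twisted_length \<Phi> \<Delta> \<rho> B (u \<circ> ?s) - twisted_length \<Phi> \<Delta> \<rho> B u) =
      (\<Sum>\<gamma>\<in>X. (?e \<gamma> - ?e (?s \<gamma>)) * (?t \<gamma> - ?t (?s \<gamma>)))"
    by (rule twisted_length_difference[OF B ss R, of "{}"]) auto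
  have "(\<Sum>\<gamma>\<in>X. (?e \<gamma> - ?e (?s \<gamma>)) * (?t \<gamma> - ?t (?s \<gamma>))) \<le> 0"
    using X(1) affine_reflection_root[OF R] by (intro sum_nonpos nonpos) blast+
  then show False using X(2) cover by simp
qed

text \<open>All summands of the length difference are nonnegative and their sum is 8. The roots
  \<open>\<alpha>\<close> and \<open>- \<alpha>\<close> contribute 4 each, which leaves no room for
  the 4 from another such \<open>\<gamma>\<close>. The name reflects that \<open>\<gamma>\<close>
  and its negated mirror image add up to a multiple of \<open>\<alpha>\<close>.\<close>

lemma twisted_cover_indecomposable:
  assumes B: "biclosed \<Phi> \<Delta> B" and ss: "simple_word ss" "u = word_prod ss"
    and \<alpha>: "\<alpha> \<in> twisted_positive B"
    and cover: "twisted_length \<Phi> \<Delta> \<rho> B (u \<circ> affine_reflection \<alpha>) = twisted_length \<Phi> \<Delta> \<rho> B u + 1"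
    and \<gamma>: "\<gamma> \<in> twisted_positive B" "u \<gamma> \<in> P"
    and \<gamma>': "- affine_reflection \<alpha> \<gamma> \<in> twisted_positive B" "u (- affine_reflection \<alpha> \<gamma>) \<in> P"
  shows "\<gamma> = \<alpha>"
proof (rule ccontr)
  assume "\<gamma> \<noteq> \<alpha>"
  have u: "symmetry u" using ss symmetry_word_prod by blast
  have H: "half_system R (twisted_positive B)" using B by (rule half_system_twisted_positive)
  have K: "half_system R (u -` P)" using u half_system_P by (rule half_system_vimage)
  have R: "\<alpha> \<in> R" "\<gamma> \<in> R" using H \<alpha> \<gamma> by (auto dest: half_systemD)
  have \<alpha>K: "\<alpha> \<in> u -` P" using twisted_cover_positive[OF B ss \<alpha> cover] by simp
  let ?s = "affine_reflection \<alpha>" and ?e = "half_sign (twisted_positive B)"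
  let ?t = "half_sign (u -` P)"
  let ?f = "\<lambda>\<gamma>. (?e \<gamma> - ?e (?s \<gamma>)) * (?t \<gamma> - ?t (?s \<gamma>))"
  note nonneg = half_sign_reflection_mult_nonneg[OF H K \<alpha> \<alpha>K]
  obtain X where X: "finite X" "X \<subseteq> R" "{\<alpha>, \<gamma>} \<subseteq> X" "\<And>\<gamma>. \<gamma> \<in> X \<Longrightarrow> - \<gamma> \<in> X"
    "8 * (twisted_length \<Phi> \<Delta> \<rho> B (u \<circ> ?s) - twisted_length \<Phi> \<Delta> \<rho> B u) = sum ?f X"
    by (rule twisted_length_difference[OF B ss R(1), of "{\<alpha>, \<gamma>}"]) (use R in auto)
  have four: "?f \<beta> = 4"
    if "\<beta> \<in> R" "?e \<beta> = 1" "?t \<beta> = 1" "- ?s \<beta> \<in> twisted_positive B" "u (- ?s \<beta>) \<in> P" for \<beta>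
  proof -
    have "?s \<beta> \<in> R" using that R affine_reflection_root by blast
    then have "?s \<beta> \<notin> twisted_positive B" "?s \<beta> \<notin> u -` P"
      using that H K by (auto dest: half_systemD)
    then show ?thesis using that by (simp add: half_sign_def)
  qed
  have s\<alpha>: "?s \<alpha> = - \<alpha>" using R affine_reflection_self fst_root_nonzero by blast
  have f\<alpha>: "?f \<alpha> = 4" using R \<alpha> \<alpha>K s\<alpha> by (intro four) (auto simp: half_sign_def)
  have f\<gamma>: "?f \<gamma> = 4" using R \<gamma> \<gamma>' by (intro four) (auto simp: half_sign_def)
  have "?f (- \<alpha>) = ?f \<alpha>"
    using half_sign_uminus[OF H R(1)] half_sign_uminus[OF K R(1)] s\<alpha>
      symmetry_uminus[OF symmetry_reflection[OF R(1)]] by (simp add: algebra_simps)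
  then have "?f (- \<alpha>) = 4" using f\<alpha> by simp
  \<comment> \<open>Opposite roots never share a half system, so the three summands taken below
    belong to different roots.\<close>
  moreover have "\<gamma> \<noteq> - \<alpha>"
    using \<alpha> \<gamma> H R by (auto dest: half_systemD)
  moreover have "- \<alpha> \<noteq> \<alpha>" using \<alpha> half_systemD(2)[OF H R(1)] by metis
  ultimately have "sum ?f {\<alpha>, - \<alpha>, \<gamma>} = 12" using f\<alpha> f\<gamma> \<open>\<gamma> \<noteq> \<alpha>\<close> by simp
  moreover have "sum ?f {\<alpha>, - \<alpha>, \<gamma>} \<le> sum ?f X"
    using X(1-4) affine_reflection_root[OF R(1)] by (intro sum_mono2 nonneg) blast+
  ultimately show False using X(5) cover by simp
qed

text \<open>Since \<open>\<Phi>\<close> is finite, it suffices to bound the members of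
  \<open>?C\<close> on each string of roots with fixed finite part.\<close>

lemma finite_twisted_cover_roots:
  assumes B: "biclosed \<Phi> \<Delta> B" and ss: "simple_word ss" "u = word_prod ss"
  shows "finite {\<alpha> \<in> twisted_positive B.
    twisted_length \<Phi> \<Delta> \<rho> B (u \<circ> affine_reflection \<alpha>) = twisted_length \<Phi> \<Delta> \<rho> B u + 1}"
    (is "finite ?C")
proof -
  have u: "symmetry u" using ss symmetry_word_prod by blast
  have H: "half_system R (twisted_positive B)" using B by (rule half_system_twisted_positive)
  have K: "half_system R (u -` P)" using u half_system_P by (rule half_system_vimage)
  have CP: "?C \<subseteq> twisted_positive B \<inter> u -` P"
    using twisted_cover_positive[OF B ss] by auto
  \<comment> \<open>Half systems are convex along a string; \<open>c\<close> is the relative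
    position of \<open>k\<close> between \<open>i\<close> and \<open>j\<close>.\<close>
  have line: "(a, real_of_int k) \<in> L"
    if L: "half_system R L" and "(a, real_of_int i) \<in> L" "(a, real_of_int j) \<in> L" "i \<le> k" "k \<le> j" for L a i j k
  proof (cases "i = j")
    case False
    define c where "c = (real_of_int k - i) / (real_of_int j - i)"
    have c: "0 \<le> c" "c \<le> 1" using that False by (auto simp: c_def)
    have "c * (real_of_int j - i) = real_of_int k - i" using that False by (simp add: c_def)
    then have e: "(a, real_of_int k) = (1 - c) *\<^sub>R (a, real_of_int i) + c *\<^sub>R (a, real_of_int j)"
      by (simp add: algebra_simps flip: scaleR_add_left)
    have "(a, real_of_int i) \<in> R" using that by (auto dest: half_systemD)
    then have "(a, real_of_int k) \<in> R" by (simp add: affine_roots_iff)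
    then show ?thesis using that c unfolding half_system_def e by (metis diff_ge_0_iff_ge)
  qed (use that in simp)
  have fin: "finite {n::int. (a, real_of_int n) \<in> ?C}" for a
  proof (rule ccontr)
    assume "infinite {n::int. (a, real_of_int n) \<in> ?C}"
    then obtain m n p where mnp: "(a, real_of_int m) \<in> ?C" "(a, real_of_int n) \<in> ?C"
      "(a, real_of_int p) \<in> ?C" "n \<noteq> m"
      "m \<le> 2 * n - m \<and> 2 * n - m \<le> p \<or> p \<le> 2 * n - m \<and> 2 * n - m \<le> m"
      by (rule infinite_int_reflection_between) auto
    have "a \<noteq> 0" using mnp(1) H fst_root_nonzero by (force simp: half_system_def)
    then have refl: "- affine_reflection (a, real_of_int n) (a, real_of_int m) =
        (a, real_of_int (2 * n - m))"
      by (simp add: affine_reflection_def affine_form_def scaleR_2)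
    \<comment> \<open>Stated for any half system containing \<open>?C\<close>, since it is needed
      for both the twisted positive roots and u^-1 P.\<close>
    have mem: "(a, real_of_int (2 * n - m)) \<in> L"
      if "half_system R L" "?C \<subseteq> L" for L
      using mnp that line[OF that(1), of a m p "2 * n - m"] line[OF that(1), of a p m "2 * n - m"]
      by blast
    have "(a, real_of_int m) = (a, real_of_int n)"
    proof (rule twisted_cover_indecomposable[OF B ss])
      show "u (a, real_of_int m) \<in> P" using mnp(1) CP by blast
      show "- affine_reflection (a, real_of_int n) (a, real_of_int m) \<in> twisted_positive B"
        unfolding refl using H CP by (intro mem) auto
      show "u (- affine_reflection (a, real_of_int n) (a, real_of_int m)) \<in> P"
        unfolding refl using mem[OF K] CP by auto
    qed (use mnp in auto)
    then show False using mnp(4) by simp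
  qed
  have "?C \<subseteq> (\<Union>a\<in>\<Phi>. (\<lambda>n. (a, real_of_int n)) ` {n. (a, real_of_int n) \<in> ?C})"
  proof
    fix \<alpha> assume \<alpha>: "\<alpha> \<in> ?C"
    then have "\<alpha> \<in> R" using H by (auto dest: half_systemD)
    then obtain n where "fst \<alpha> \<in> \<Phi>" "\<alpha> = (fst \<alpha>, real_of_int n)"
      by (auto simp: affine_roots_iff prod_eq_iff elim: Ints_cases)
    then show "\<alpha> \<in> (\<Union>a\<in>\<Phi>. (\<lambda>n. (a, real_of_int n)) ` {n. (a, real_of_int n) \<in> ?C})"
      using \<alpha> by (intro UN_I[of "fst \<alpha>"] image_eqI[of _ _ n]) auto
  qed
  then show ?thesis
    by (rule finite_subset) (use finite_roots fin in blast)
qed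

section \<open>Finite branching and chains of covers\<close>

lemma twisted_step_word:
  assumes "simple_word ss" "twisted_step \<Phi> \<Delta> \<rho> B (word_prod ss) v"
  shows "\<exists>ts. simple_word ts \<and> v = word_prod ts"
proof -
  obtain \<gamma> where "\<gamma> \<in> R" "v = affine_reflection \<gamma> \<circ> word_prod ss"
    using assms by (auto simp: twisted_step_def)
  then show ?thesis
    using root_reflection_is_word assms(1) by (metis simple_word_simps(3) word_prod_simps(3))
qed

text \<open>A reflection in \<open>u \<alpha>\<close> on the left of \<open>u\<close> is the
  reflection in \<open>\<alpha>\<close> on its right. As \<open>\<alpha>\<close> and
  \<open>- \<alpha>\<close> give the same reflection, the one in \<open>twisted_positive B\<close>
  may be taken.\<close>

lemma finite_twisted_steps:
  assumes B: "biclosed \<Phi> \<Delta> B" and ss: "simple_word ss" "u = word_prod ss"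
  shows "finite {v. twisted_step \<Phi> \<Delta> \<rho> B u v}"
proof -
  let ?C = "{\<alpha> \<in> twisted_positive B.
    twisted_length \<Phi> \<Delta> \<rho> B (u \<circ> affine_reflection \<alpha>) = twisted_length \<Phi> \<Delta> \<rho> B u + 1}"
  have u: "symmetry u" using ss symmetry_word_prod by blast
  have H: "half_system R (twisted_positive B)" using B by (rule half_system_twisted_positive)
  have "{v. twisted_step \<Phi> \<Delta> \<rho> B u v} \<subseteq> (\<lambda>\<alpha>. u \<circ> affine_reflection \<alpha>) ` ?C"
  proof
    fix v assume "v \<in> {v. twisted_step \<Phi> \<Delta> \<rho> B u v}"
    then obtain \<gamma> where \<gamma>: "\<gamma> \<in> R" "v = affine_reflection \<gamma> \<circ> u"
      and len: "twisted_length \<Phi> \<Delta> \<rho> B v = twisted_length \<Phi> \<Delta> \<rho> B u + 1"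
      by (auto simp: twisted_step_def)
    obtain \<alpha> where \<alpha>: "\<alpha> \<in> R" "\<gamma> = u \<alpha>" using \<gamma>(1) u unfolding symmetry_def by (metis imageE)
    have v: "v = u \<circ> affine_reflection \<alpha>" using \<gamma>(2) \<alpha>(2) symmetry_reflection_conj[OF u] by simp
    have "\<alpha> \<in> twisted_positive B \<or> - \<alpha> \<in> twisted_positive B"
      using H \<alpha>(1) by (auto dest: half_systemD)
    then show "v \<in> (\<lambda>\<alpha>. u \<circ> affine_reflection \<alpha>) ` ?C"
    proof
      assume "\<alpha> \<in> twisted_positive B"
      then show ?thesis using v len by blast
    next
      assume "- \<alpha> \<in> twisted_positive B"
      then show ?thesis using v len by (intro image_eqI[of _ _ "- \<alpha>"]) (auto simp: affine_reflection_uminus)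
    qed
  qed
  then show ?thesis using finite_twisted_cover_roots[OF assms] finite_surj by blast
qed

text \<open>By finite branching each level is a finite union of finite sets. The induction also
  records that the elements are words, as \<open>finite_twisted_steps\<close> requires, and that
  every step raises the twisted length by exactly 1.\<close>

lemma finite_twisted_steps_power:
  assumes B: "biclosed \<Phi> \<Delta> B" and ss: "simple_word ss" "x = word_prod ss"
  shows "finite {z. (twisted_step \<Phi> \<Delta> \<rho> B ^^ n) x z} \<and>
    (\<forall>z. (twisted_step \<Phi> \<Delta> \<rho> B ^^ n) x z \<longrightarrow> (\<exists>ts. simple_word ts \<and> z = word_prod ts) \<and>
      twisted_length \<Phi> \<Delta> \<rho> B z = twisted_length \<Phi> \<Delta> \<rho> B x + int n)"
proof (induction n)
  case 0
  have "{z. z = x} = {x}" by blast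
  then show ?case using ss by auto
next
  case (Suc n)
  let ?T = "twisted_step \<Phi> \<Delta> \<rho> B"
  have "{z. (?T ^^ Suc n) x z} = (\<Union>y\<in>{y. (?T ^^ n) x y}. {z. ?T y z})"
    by (auto simp: relcompp.simps)
  moreover have "finite {z. ?T y z}" if "(?T ^^ n) x y" for y
    using Suc.IH that finite_twisted_steps[OF B] by blast
  ultimately have "finite {z. (?T ^^ Suc n) x z}" using Suc.IH by auto
  moreover have "(\<exists>ts. simple_word ts \<and> z = word_prod ts) \<and>
      twisted_length \<Phi> \<Delta> \<rho> B z = twisted_length \<Phi> \<Delta> \<rho> B x + int (Suc n)"
    if step: "(?T ^^ Suc n) x z" for z
  proof -
    obtain y where y: "(?T ^^ n) x y" "?T y z" using step by (rule relpowp_Suc_E)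
    then obtain ts where ts: "simple_word ts" "y = word_prod ts"
      and len: "twisted_length \<Phi> \<Delta> \<rho> B y = twisted_length \<Phi> \<Delta> \<rho> B x + int n"
      using Suc.IH by blast
    have "\<exists>us. simple_word us \<and> z = word_prod us"
      using twisted_step_word[OF ts(1)] y(2) ts(2) by blast
    moreover have "twisted_length \<Phi> \<Delta> \<rho> B z = twisted_length \<Phi> \<Delta> \<rho> B y + 1"
      using y(2) by (simp add: twisted_step_def)
    ultimately show ?thesis using len by simp
  qed
  ultimately show ?case by blast
qed

end

theorem theorem3p6:
  fixes \<Phi> \<Delta> :: "'a::euclidean_space set" and \<rho> :: 'a
    and B :: "('a \<times> real) set" and x y :: "'a \<times> real \<Rightarrow> 'a \<times> real"
  assumes "crystallographic_root_system \<Phi>"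
    and "irreducible_roots \<Phi>"
    and "simple_system \<Phi> \<Delta>"
    and "highest_root \<Phi> \<Delta> \<rho>"
    and "biclosed \<Phi> \<Delta> B"
    and "x \<in> affine_weyl_group \<Phi> \<Delta>"
    and "y \<in> affine_weyl_group \<Phi> \<Delta>"
    and "twisted_le \<Phi> \<Delta> \<rho> B x y"
    and "x \<noteq> y"
  shows "finite (twisted_interval \<Phi> \<Delta> \<rho> B x y)"
proof -
  interpret affine_root_datum \<Phi> \<Delta> \<rho>
    using assms(1,3,4) by (rule affine_root_datum.intro)
  let ?T = "twisted_step \<Phi> \<Delta> \<rho> B" and ?l = "twisted_length \<Phi> \<Delta> \<rho> B"
  obtain ss where ss: "simple_word ss" "x = word_prod ss"
    using affine_weyl_group_word assms(6) by blast
  note power = finite_twisted_steps_power[OF assms(5)]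
  \<comment> \<open>A chain from \<open>x\<close> to \<open>z\<close> has exactly
    \<open>?l z - ?l x\<close> steps, at most \<open>?l y - ?l x\<close> because a chain leads on
    from \<open>z\<close> to \<open>y\<close>. So only finitely many levels above \<open>x\<close>
    occur.\<close>
  have "twisted_interval \<Phi> \<Delta> \<rho> B x y \<subseteq> (\<Union>n\<le>nat (?l y - ?l x). {z. (?T ^^ n) x z})"
  proof
    fix z assume "z \<in> twisted_interval \<Phi> \<Delta> \<rho> B x y"
    then have z: "?T\<^sup>*\<^sup>* x z" "?T\<^sup>*\<^sup>* z y" "z \<in> affine_weyl_group \<Phi> \<Delta>"
      by (auto simp: twisted_interval_def twisted_le_def)
    obtain ts where ts: "simple_word ts" "z = word_prod ts"
      using affine_weyl_group_word z(3) by blast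
    obtain m n where mn: "(?T ^^ m) x z" "(?T ^^ n) z y"
      using z rtranclp_imp_relpowp by metis
    have "?l z = ?l x + int m" "?l y = ?l z + int n"
      using power[OF ss] power[OF ts] mn by blast+
    then show "z \<in> (\<Union>n\<le>nat (?l y - ?l x). {z. (?T ^^ n) x z})"
      using mn by (intro UN_I[of m]) auto
  qed
  moreover have "finite (\<Union>n\<le>nat (?l y - ?l x). {z. (?T ^^ n) x z})"
    using power[OF ss] by blast
  ultimately show ?thesis by (rule finite_subset)
qed

end
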